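(* Let $p$ be a prime with $p \equiv \pm 1 \pmod{10}$ and $p \equiv 1 \pmod 4$, and let $G = \mathrm{PSL}(2,p)$. If $m(G) = 3$, then $G$ fails the replacement property.
   Context: For a finite group $G$, a finite sequence $s=(g_1,\dots,g_k)$ of elements of $G$ is an irredundant generating sequence if $\langle g_1,\dots,g_k\rangle = G$ and $g_i \notin \langle g_j : j \neq i\rangle$ for every $i$. $m(G)$ denotes the maximal length of an irredundant generating sequence of $G$. An irredundant generating sequence $s=(g_1,\dots,g_k)$ satisfies the replacement property if for every nontrivial $g \in G$ there is an index $i$ such that $(g_1,\dots,g_{i-1},g,g_{i+1},\dots,g_k)$ generates $G$ (not necessarily irredundantly). $G$ satisfies the replacement property if every irredundant generating sequence of length $m(G)$ satisfies it; $G$ fails the replacement property otherwise. *)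

theory Defs
  imports "HOL-Algebra.Algebra" "HOL-Computational_Algebra.Primes"
begin

definition SL2 :: "int \<Rightarrow> (int \<times> int \<times> int \<times> int) monoid" where
  "SL2 p = \<lparr> carrier = {(x1,x2,x3,x4). 0 \<le> x1 \<and> x1 < p \<and> 0 \<le> x2 \<and> x2 < p \<and> 0 \<le> x3 \<and> x3 < p
                                    \<and> 0 \<le> x4 \<and> x4 < p \<and> (x1*x4 - x2*x3) mod p = 1},
            monoid.mult = (\<lambda>(x1,x2,x3,x4) (y1,y2,y3,y4).
                      ((x1*y1 + x2*y3) mod p, (x1*y2 + x2*y4) mod p,
                       (x3*y1 + x4*y3) mod p, (x3*y2 + x4*y4) mod p)),
            monoid.one = (1,0,0,1) \<rparr>"

definition centre_SL2 :: "int \<Rightarrow> (int \<times> int \<times> int \<times> int) set" where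
  "centre_SL2 p = {(1,0,0,1), (p-1,0,0,p-1)}"

definition PSL2 :: "int \<Rightarrow> (int \<times> int \<times> int \<times> int) set monoid" where
  "PSL2 p = SL2 p Mod centre_SL2 p"

definition irredundant_gen_seq :: "('a, 'b) monoid_scheme \<Rightarrow> 'a list \<Rightarrow> bool" where
  "irredundant_gen_seq G s \<longleftrightarrow>
     set s \<subseteq> carrier G \<and>
     generate G (set s) = carrier G \<and>
     (\<forall>i < length s. s ! i \<notin> generate G {s ! j | j. j < length s \<and> j \<noteq> i})"

definition max_irr_len :: "('a, 'b) monoid_scheme \<Rightarrow> nat" where
  "max_irr_len G = (GREATEST k. \<exists>s. irredundant_gen_seq G s \<and> length s = k)"

definition seq_replacement_property :: "('a, 'b) monoid_scheme \<Rightarrow> 'a list \<Rightarrow> bool" where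
  "seq_replacement_property G s \<longleftrightarrow>
     (\<forall>g \<in> carrier G. g \<noteq> \<one>\<^bsub>G\<^esub> \<longrightarrow>
        (\<exists>i < length s. generate G (set (s[i := g])) = carrier G))"

definition replacement_property :: "('a, 'b) monoid_scheme \<Rightarrow> bool" where
  "replacement_property G \<longleftrightarrow>
     (\<forall>s. irredundant_gen_seq G s \<and> length s = max_irr_len G \<longrightarrow> seq_replacement_property G s)"

end

theory Submission
  imports Defs "HOL-Number_Theory.Number_Theory"
begin

text \<open>
  Since \<open>-1\<close> and \<open>5\<close> are squares modulo \<open>p\<close>, \<open>SL(2,p)\<close> is the group of unit quaternions over
  \<open>\<int>/p\<close>, and the icosahedral group lives in \<open>PSL(2,p)\<close>, with \<open>\<phi>\<close> the golden ratio. Take the half-turns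
  \<open>z = k\<close>, \<open>g3 = i\<close> and the rotation \<open>g2\<close> of order 3 about \<open>r = (\<phi>-1) i + \<phi> j\<close> in one icosahedral group
  \<open>H1\<close>, and let \<open>g1 = r g3 r\<inverse>\<close>. Then \<open>g2, g3, z \<in> H1\<close>; \<open>g1, g3, z\<close> lie in the centraliser \<open>H2\<close> of \<open>z\<close> in
  \<open>PSL(2,p)\<close>; and \<open>g1, g2, z\<close> lie in the second icosahedral group \<open>H3 = r H1 r\<inverse>\<close>. As \<open>g1 \<notin> H1\<close>, \<open>g2 \<notin> H2\<close>
  and \<open>g3 \<notin> H3\<close>, the three elements are irredundant, and replacing any \<open>g\<^sub>i\<close> by \<open>z\<close> leaves a subset of the proper
  subgroup \<open>H\<^sub>i\<close>.

  It remains to see that \<open>g1, g2, g3\<close> generate. If their span \<open>K\<close> contains a nontrivial unipotent, it contains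
  transvections in two directions and is everything. Otherwise every noncentral centraliser in \<open>K\<close> is
  abelian and has index at most 2 in its normaliser, and the counting argument of the classification of
  the finite rotation groups shows that an element of order at least 6 in \<open>PSL(2,p)\<close>, here \<open>g1 g3\<close>, has a
  centraliser that is normal in \<open>K\<close>; but \<open>g2\<close> does not normalise it.
\<close>

section \<open>The group \<open>SL(2,p)\<close>\<close>

lemma SL2_mult:
  "(a,b,c,d) \<otimes>\<^bsub>SL2 p\<^esub> (a',b',c',d') =
    ((a*a' + b * c') mod p, (a*b' + b*d') mod p, (c*a' + d * c') mod p, (c*b' + d*d') mod p)"
  by (simp add: SL2_def)

lemma SL2_one: "\<one>\<^bsub>SL2 p\<^esub> = (1,0,0,1)"
  by (simp add: SL2_def)

lemma SL2_carrier:
  "(a,b,c,d) \<in> carrier (SL2 p) \<longleftrightarrow> 0 \<le> a \<and> a < p \<and> 0 \<le> b \<and> b < p \<and> 0 \<le> c \<and> c < p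
     \<and> 0 \<le> d \<and> d < p \<and> (a*d - b * c) mod p = 1"
  by (simp add: SL2_def)

lemma mod_lincomb:
  fixes p :: int
  shows "(x * (y mod p) + z * (w mod p)) mod p = (x*y + z*w) mod p"
    and "((y mod p) * x + (w mod p) * z) mod p = (y*x + w*z) mod p"
    and "((y mod p) * (x mod p) - (w mod p) * (z mod p)) mod p = (y*x - w*z) mod p"
  by (intro mod_add_cong mod_diff_cong; simp add: mod_simps)+

text \<open>The multiplication of \<^term>\<open>SL2 p\<close> is used on arbitrary integer matrices, reduced or not.\<close>

lemma SL2_assoc: "(x \<otimes>\<^bsub>SL2 p\<^esub> y) \<otimes>\<^bsub>SL2 p\<^esub> z = x \<otimes>\<^bsub>SL2 p\<^esub> (y \<otimes>\<^bsub>SL2 p\<^esub> z)"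
proof -
  obtain a b c d where x: "x = (a,b,c,d)" by (cases x)
  obtain a' b' c' d' where y: "y = (a',b',c',d')" by (cases y)
  obtain a'' b'' c'' d'' where z: "z = (a'',b'',c'',d'')" by (cases z)
  show ?thesis unfolding x y z SL2_mult
    by (simp only: mod_lincomb prod.inject) (simp only: ring_distribs ac_simps simp_thms)
qed

definition red :: "int \<Rightarrow> int \<times> int \<times> int \<times> int \<Rightarrow> int \<times> int \<times> int \<times> int" where
  "red p = (\<lambda>(a,b,c,d). (a mod p, b mod p, c mod p, d mod p))"

lemma red_simp [simp]: "red p (a,b,c,d) = (a mod p, b mod p, c mod p, d mod p)"
  by (simp add: red_def)

text \<open>Products are reduced in any case, so reductions of the factors may be dropped; a matrix
  identity then becomes four divisibility claims between integer polynomials.\<close>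

lemma mult_red:
  "red p x \<otimes>\<^bsub>SL2 p\<^esub> y = x \<otimes>\<^bsub>SL2 p\<^esub> y"
  "x \<otimes>\<^bsub>SL2 p\<^esub> red p y = x \<otimes>\<^bsub>SL2 p\<^esub> y"
  "red p (x \<otimes>\<^bsub>SL2 p\<^esub> y) = x \<otimes>\<^bsub>SL2 p\<^esub> y"
  by (cases x; cases y; simp add: SL2_mult mod_lincomb)+

lemma one_mult:
  "\<one>\<^bsub>SL2 p\<^esub> \<otimes>\<^bsub>SL2 p\<^esub> x = red p x"  "x \<otimes>\<^bsub>SL2 p\<^esub> \<one>\<^bsub>SL2 p\<^esub> = red p x"
  by (cases x; simp add: SL2_mult SL2_one)+

lemma red_carrier: "x \<in> carrier (SL2 p) \<Longrightarrow> red p x = x"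
  by (cases x) (auto simp: SL2_carrier)

section \<open>Group structure, inverses and centre modulo an odd prime\<close>

locale odd_prime =
  fixes p :: int
  assumes prime_p: "Factorial_Ring.prime p" and p_gt_2: "p > 2"
begin

abbreviation mult2 (infixl "\<star>" 70) where "x \<star> y \<equiv> x \<otimes>\<^bsub>SL2 p\<^esub> y"

lemma red_in_carrier: "p dvd a*d - b * c - 1 \<Longrightarrow> red p (a,b,c,d) \<in> carrier (SL2 p)"
proof -
  assume "p dvd a*d - b * c - 1"
  then have "(a*d - b * c) mod p = 1 mod p" by (simp only: mod_eq_dvd_iff)
  then show ?thesis using p_gt_2 by (simp add: SL2_carrier mod_lincomb)
qed

lemma carrier_dvd: "(a,b,c,d) \<in> carrier (SL2 p) \<Longrightarrow> p dvd a*d - b * c - 1"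
proof -
  assume "(a,b,c,d) \<in> carrier (SL2 p)"
  then have "(a*d - b * c) mod p = 1 mod p" using p_gt_2 by (simp add: SL2_carrier)
  then show ?thesis by (simp only: mod_eq_dvd_iff)
qed

lemma mod_eq_iff: "x mod p = y mod p \<longleftrightarrow> p dvd x - y"
  by (simp add: mod_eq_dvd_iff)

lemma p_dvd_mult_iff: "p dvd x * y \<longleftrightarrow> p dvd x \<or> p dvd y"
  using prime_p by (simp add: prime_dvd_mult_iff)

lemma inverse_mod:
  assumes "\<not> p dvd x" obtains y where "p dvd x * y - 1"
proof -
  have "coprime x p" using prime_p assms
    by (metis coprime_commute prime_imp_coprime)
  then obtain y where "[x * y = 1] (mod p)" by (metis cong_solve_coprime_int)
  then show ?thesis using that by (simp add: cong_iff_dvd_diff)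
qed

text \<open>The adjugate inverts a matrix of determinant 1.\<close>

lemma inv_eq:
  assumes "(a,b,c,d) \<in> carrier (SL2 p)"
  shows "red p (d,-b,-c,a) \<in> carrier (SL2 p)"
    and "red p (d,-b,-c,a) \<star> (a,b,c,d) = \<one>\<^bsub>SL2 p\<^esub>"
proof -
  from carrier_dvd[OF assms] have D: "p dvd a*d - b * c - 1" .
  show "red p (d,-b,-c,a) \<in> carrier (SL2 p)"
    by (rule red_in_carrier) (use D in \<open>simp add: algebra_simps\<close>)
  have "(d*a - b * c) mod p = 1" "(a*d - b * c) mod p = 1"
    using assms by (auto simp: SL2_carrier mult.commute)
  then show "red p (d,-b,-c,a) \<star> (a,b,c,d) = \<one>\<^bsub>SL2 p\<^esub>"
    unfolding mult_red(1) SL2_mult SL2_one by (auto simp: algebra_simps)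
qed

lemma group_SL2: "group (SL2 p)"
proof (rule groupI)
  fix x y assume *: "x \<in> carrier (SL2 p)" "y \<in> carrier (SL2 p)"
  obtain a b c d where x: "x = (a,b,c,d)" by (cases x)
  obtain a' b' c' d' where y: "y = (a',b',c',d')" by (cases y)
  have "p dvd a*d - b * c - 1" "p dvd a'*d' - b' * c' - 1"
    using * carrier_dvd x y by auto
  then have "p dvd (a*d - b * c - 1) * (a'*d' - b' * c') + (a'*d' - b' * c' - 1)" by simp
  moreover have "(a*d - b * c - 1) * (a'*d' - b' * c') + (a'*d' - b' * c' - 1) =
     (a*a' + b * c') * (c*b' + d*d') - (a*b' + b*d') * (c*a' + d * c') - 1"
    by (simp add: algebra_simps)
  ultimately show "x \<star> y \<in> carrier (SL2 p)"
    using red_in_carrier unfolding x y SL2_mult red_simp[symmetric] by auto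
next
  show "\<one>\<^bsub>SL2 p\<^esub> \<in> carrier (SL2 p)" using p_gt_2 by (simp add: SL2_one SL2_carrier)
next
  fix x assume *: "x \<in> carrier (SL2 p)"
  show "\<one>\<^bsub>SL2 p\<^esub> \<star> x = x" using * by (simp add: one_mult red_carrier)
  show "\<exists>y\<in>carrier (SL2 p). y \<star> x = \<one>\<^bsub>SL2 p\<^esub>"
    using inv_eq * by (cases x) blast
qed (rule SL2_assoc)

sublocale group "SL2 p" by (rule group_SL2)

lemma inv_SL2: "(a,b,c,d) \<in> carrier (SL2 p) \<Longrightarrow> inv\<^bsub>SL2 p\<^esub> (a,b,c,d) = red p (d,-b,-c,a)"
  using inv_eq by (metis inv_equality)

lemma finite_SL2: "finite (carrier (SL2 p))"
proof -
  have "carrier (SL2 p) \<subseteq> {0..p} \<times> {0..p} \<times> {0..p} \<times> {0..p}"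
    by (auto simp: SL2_carrier)
  then show ?thesis by (rule finite_subset) auto
qed

lemma eq_if_dvd:
  assumes "(a,b,c,d) \<in> carrier (SL2 p)" "(a',b',c',d') \<in> carrier (SL2 p)"
    "p dvd a - a'" "p dvd b - b'" "p dvd c - c'" "p dvd d - d'"
  shows "(a,b,c,d) = (a',b',c',d')"
proof -
  have "red p (a,b,c,d) = red p (a',b',c',d')" using assms(3-) by (simp add: mod_eq_iff)
  then show ?thesis using assms(1,2) by (simp only: red_carrier)
qed

text \<open>For a scalar matrix of determinant 1 with entry \<open>a\<close>, the prime
  \<open>p\<close> divides \<open>a - 1\<close> or \<open>a + 1\<close>, and the entries are
  reduced. Expressing centrality by divisibility opens it to polynomial arguments.\<close>

lemma centre_iff:
  assumes "(a,b,c,d) \<in> carrier (SL2 p)"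
  shows "(a,b,c,d) \<in> centre_SL2 p \<longleftrightarrow> p dvd b \<and> p dvd c \<and> p dvd a - d"
proof
  assume "(a,b,c,d) \<in> centre_SL2 p" then show "p dvd b \<and> p dvd c \<and> p dvd a - d"
    by (auto simp: centre_SL2_def)
next
  assume *: "p dvd b \<and> p dvd c \<and> p dvd a - d"
  from carrier_dvd[OF assms] have D: "p dvd a*d - b * c - 1" .
  have "b = 0" "c = 0" using * assms zdvd_imp_le by (force simp: SL2_carrier)+
  have "a = d" using assms * by (auto simp: SL2_carrier mod_eq_iff[symmetric])
  have "p dvd (a-1)*(a+1)" using D \<open>a = d\<close> \<open>b = 0\<close> by (simp add: algebra_simps)
  then have "p dvd a - 1 \<or> p dvd a - (p-1)" unfolding p_dvd_mult_iff
    by (metis add.commute diff_add_eq diff_diff_eq2 dvd_add_right_iff dvd_refl dvd_diff minus_dvd_iff minus_diff_eq)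
  then have "a mod p = 1 mod p \<or> a mod p = (p-1) mod p" by (simp only: mod_eq_iff)
  moreover have "a mod p = a" "1 mod p = 1" using assms p_gt_2 by (auto simp: SL2_carrier)
  moreover have "(p-1) mod p = p-1" using p_gt_2 by (intro mod_pos_pos_trivial) auto
  ultimately have "a = 1 \<or> a = p - 1" by (simp only:)
  then show "(a,b,c,d) \<in> centre_SL2 p" using \<open>a = d\<close> \<open>b = 0\<close> \<open>c = 0\<close>
    by (auto simp: centre_SL2_def)
qed

end

section \<open>Groups in which commuting is transitive off the centre\<close>

text \<open>The properties of a subgroup of SL(2,p) that contains the centre but no noncentral
  element of trace 2 or -2. There noncentral centralisers lie in tori, and \<open>flip\<close> says
  that the Weyl group of a torus has order at most 2.\<close>

locale commutation_transitive = group G for G (structure) +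
  fixes Z
  assumes finite_G: "finite (carrier G)"
    and subgroup_Z: "subgroup Z G"
    and central: "\<lbrakk>z \<in> Z; x \<in> carrier G\<rbrakk> \<Longrightarrow> z \<otimes> x = x \<otimes> z"
    and commute_trans: "\<lbrakk>x \<in> carrier G; y \<in> carrier G; w \<in> carrier G; y \<notin> Z;
      x \<otimes> y = y \<otimes> x; y \<otimes> w = w \<otimes> y\<rbrakk> \<Longrightarrow> x \<otimes> w = w \<otimes> x"
    and flip: "\<lbrakk>x \<in> carrier G; x \<notin> Z; y \<in> carrier G;
      (y \<otimes> x \<otimes> inv y) \<otimes> x = x \<otimes> (y \<otimes> x \<otimes> inv y)\<rbrakk> \<Longrightarrow> y \<otimes> x \<otimes> inv y \<in> {x, inv x}"
begin

definition conj where "conj g x = g \<otimes> x \<otimes> inv g"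
definition cent where "cent x = {y \<in> carrier G. y \<otimes> x = x \<otimes> y}"
text \<open>For noncentral \<open>x\<close> this is the normaliser of \<open>cent x\<close>: once
  \<open>conj y x\<close> commutes with \<open>x\<close>, transitivity carries all of
  \<open>cent x\<close> into itself.\<close>

definition cent_normalizer where "cent_normalizer x = {y \<in> carrier G. conj y x \<in> cent x}"
text \<open>The union of the conjugates of \<open>cent x\<close>, without \<open>Z\<close>.\<close>

definition cent_class where "cent_class x = {y \<in> carrier G - Z. \<exists>g \<in> carrier G. conj g y \<in> cent x}"

lemma Z_carrier: "z \<in> Z \<Longrightarrow> z \<in> carrier G"
  using subgroup.mem_carrier[OF subgroup_Z] .

lemma conj_closed [simp]: "\<lbrakk>g \<in> carrier G; x \<in> carrier G\<rbrakk> \<Longrightarrow> conj g x \<in> carrier G"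
  by (simp add: conj_def)

lemma conj_mult: "\<lbrakk>g \<in> carrier G; k \<in> carrier G; x \<in> carrier G\<rbrakk> \<Longrightarrow> conj (g \<otimes> k) x = conj g (conj k x)"
  by (simp add: conj_def m_assoc inv_mult_group)

lemma conj_one [simp]: "x \<in> carrier G \<Longrightarrow> conj \<one> x = x"
  by (simp add: conj_def)

lemma conj_inv [simp]: "\<lbrakk>g \<in> carrier G; x \<in> carrier G\<rbrakk> \<Longrightarrow> conj (inv g) (conj g x) = x"
  "\<lbrakk>g \<in> carrier G; x \<in> carrier G\<rbrakk> \<Longrightarrow> conj g (conj (inv g) x) = x"
  by (simp_all flip: conj_mult)

lemma conj_hom: "\<lbrakk>g \<in> carrier G; x \<in> carrier G; y \<in> carrier G\<rbrakk> \<Longrightarrow> conj g (x \<otimes> y) = conj g x \<otimes> conj g y"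
  by (simp add: conj_def m_assoc inv_solve_left)

lemma conj_cent: "\<lbrakk>g \<in> carrier G; x \<in> carrier G; y \<in> cent x\<rbrakk> \<Longrightarrow> conj g y \<in> cent (conj g x)"
  by (auto simp: cent_def simp flip: conj_hom)

lemma conj_Z:
  assumes "g \<in> carrier G" "z \<in> Z" shows "conj g z = z"
proof -
  have "conj g z = z \<otimes> g \<otimes> inv g" using central[OF assms(2,1)] by (simp add: conj_def)
  then show ?thesis using assms Z_carrier by (simp add: m_assoc)
qed

lemma conj_Z_iff: "\<lbrakk>g \<in> carrier G; x \<in> carrier G\<rbrakk> \<Longrightarrow> conj g x \<in> Z \<longleftrightarrow> x \<in> Z"
  by (metis conj_Z conj_inv(1) inv_closed)

lemma cent_sym: "x \<in> carrier G \<Longrightarrow> y \<in> cent x \<Longrightarrow> x \<in> cent y"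
  by (auto simp: cent_def)

lemma cent_trans: "\<lbrakk>x \<in> carrier G; y \<notin> Z; w \<in> cent y; y \<in> cent x\<rbrakk> \<Longrightarrow> w \<in> cent x"
  unfolding cent_def using commute_trans by auto

lemma cent_carrier: "y \<in> cent x \<Longrightarrow> y \<in> carrier G"
  by (simp add: cent_def)

lemma subgroup_cent:
  assumes x: "x \<in> carrier G" shows "subgroup (cent x) G"
proof (rule subgroupI)
  show "cent x \<subseteq> carrier G" by (auto simp: cent_def)
  show "cent x \<noteq> {}" using x by (auto simp: cent_def)
  fix a assume a: "a \<in> cent x"
  then have aG: "a \<in> carrier G" and "inv a \<otimes> (x \<otimes> a) \<otimes> inv a = inv a \<otimes> (a \<otimes> x) \<otimes> inv a"
    by (simp_all add: cent_def)
  moreover have "inv a \<otimes> (a \<otimes> x) \<otimes> inv a = x \<otimes> inv a" using x aG by (simp flip: m_assoc)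
  moreover have "inv a \<otimes> (x \<otimes> a) \<otimes> inv a = inv a \<otimes> x" using x aG by (simp add: m_assoc)
  ultimately show "inv a \<in> cent x" using x by (simp add: cent_def)
next
  fix a b assume "a \<in> cent x" "b \<in> cent x"
  then show "a \<otimes> b \<in> cent x" using x by (auto simp: cent_def) (metis m_assoc)
qed

lemma Z_cent: "x \<in> carrier G \<Longrightarrow> Z \<subseteq> cent x"
  using central Z_carrier by (auto simp: cent_def)

section \<open>Counting noncentral elements by classes of centralisers\<close>

lemma finite_sub: "finite (cent x)" "finite (cent_normalizer x)" "finite (cent_class x)"
  by (rule finite_subset[OF _ finite_G]; auto simp: cent_def cent_normalizer_def cent_class_def)+

text \<open>By \<open>flip\<close>, every element of the normaliser outside \<open>cent x\<close>
  inverts \<open>x\<close>. Two such elements differ by a factor in \<open>cent x\<close>, so there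
  is at most one coset besides \<open>cent x\<close>.\<close>

lemma card_cent_normalizer:
  assumes x: "x \<in> carrier G" "x \<notin> Z"
  shows "card (cent_normalizer x) = card (cent x) \<or> card (cent_normalizer x) = 2 * card (cent x)"
proof (cases "cent_normalizer x \<subseteq> cent x")
  case True
  have "cent x \<subseteq> cent_normalizer x"
  proof
    fix y assume "y \<in> cent x"
    then have "y \<in> carrier G" "conj y x = x" using x by (auto simp: cent_def conj_def m_assoc)
    then show "y \<in> cent_normalizer x" using x by (simp add: cent_normalizer_def cent_def)
  qed
  then show ?thesis using True by auto
next
  case False
  then obtain k where k: "k \<in> cent_normalizer x" "k \<notin> cent x" by auto
  have flips: "conj y x = inv x" if "y \<in> cent_normalizer x" "y \<notin> cent x" for y
  proof -
    have y: "y \<in> carrier G" and c: "conj y x \<in> cent x" using that by (auto simp: cent_normalizer_def)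
    then have "conj y x \<in> {x, inv x}" unfolding conj_def using flip x by (auto simp: cent_def)
    moreover have "conj y x \<noteq> x"
    proof
      assume "conj y x = x"
      then have "y \<otimes> x = x \<otimes> y" using x y by (simp add: conj_def inv_solve_right')
      then show False using that y by (simp add: cent_def)
    qed
    ultimately show ?thesis by auto
  qed
  have kG: "k \<in> carrier G" using k by (simp add: cent_normalizer_def)
  have ki: "conj (inv k) (inv x) = x" using flips[OF k] kG x by (metis conj_inv(1))
  have kx: "conj k x = inv x" using flips[OF k] .
  have eq: "cent_normalizer x = cent x \<union> (\<lambda>c. k \<otimes> c) ` cent x"
  proof (intro equalityI subsetI)
    fix y assume y: "y \<in> cent_normalizer x"
    then have yG: "y \<in> carrier G" by (simp add: cent_normalizer_def)
    show "y \<in> cent x \<union> (\<lambda>c. k \<otimes> c) ` cent x"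
    proof (cases "y \<in> cent x")
      case False
      have "conj (inv k \<otimes> y) x = x" using flips[OF y False] ki yG kG x by (simp add: conj_mult)
      then have "(inv k \<otimes> y) \<otimes> x = x \<otimes> (inv k \<otimes> y)"
        using x yG kG by (simp only: conj_def inv_solve_right' inv_closed m_closed)
      then have "inv k \<otimes> y \<in> cent x" using kG yG by (simp add: cent_def)
      moreover have "y = k \<otimes> (inv k \<otimes> y)" using kG yG by (simp flip: m_assoc)
      ultimately show ?thesis by blast
    qed auto
  next
    fix y assume "y \<in> cent x \<union> (\<lambda>c. k \<otimes> c) ` cent x"
    moreover have fixc: "conj c x = x" if "c \<in> cent x" for c
      using that x by (auto simp: cent_def conj_def m_assoc)
    moreover have "x \<in> cent x" "inv x \<in> cent x" using x by (auto simp: cent_def)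
    ultimately show "y \<in> cent_normalizer x" using x kG kx by (auto simp: cent_normalizer_def conj_mult cent_carrier)
  qed
  have "cent x \<inter> (\<lambda>c. k \<otimes> c) ` cent x = {}"
  proof -
    have False if "c \<in> cent x" "k \<otimes> c \<in> cent x" for c
    proof -
      have "k \<otimes> c \<otimes> inv c \<in> cent x"
        using that subgroup_cent[OF x(1)] by (metis subgroup.m_closed subgroup.m_inv_closed)
      then show False using k kG that by (simp add: m_assoc cent_carrier)
    qed
    then show ?thesis by auto
  qed
  moreover have "card ((\<lambda>c. k \<otimes> c) ` cent x) = card (cent x)"
    by (rule card_image) (use kG in \<open>auto intro!: inj_onI simp: cent_carrier\<close>)
  ultimately show ?thesis unfolding eq by (simp add: card_Un_disjoint finite_sub)
qed

text \<open>Double count of the pairs \<open>(g, c)\<close> with \<open>c\<close> in the noncentral part of \<open>cent x\<close>: they are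
  parametrised by the conjugate \<open>conj g c\<close> together with an element of \<open>cent_normalizer x\<close>.\<close>

lemma card_cent_class:
  assumes x: "x \<in> carrier G" "x \<notin> Z"
  shows "card (cent_class x) * card (cent_normalizer x) = card (carrier G) * (card (cent x) - card Z)"
proof -
  \<comment> \<open>One fixed conjugator per element \<open>y\<close>; the map and its inverse below
    must share this choice.\<close>
  define g0 where "g0 y = (SOME g. g \<in> carrier G \<and> conj (inv g) y \<in> cent x)" for y
  have g0: "g0 y \<in> carrier G \<and> conj (inv (g0 y)) y \<in> cent x" if y: "y \<in> cent_class x" for y
  proof -
    obtain g where "g \<in> carrier G" "conj g y \<in> cent x" using y by (auto simp: cent_class_def)
    then have "inv g \<in> carrier G \<and> conj (inv (inv g)) y \<in> cent x" by simp
    then show ?thesis unfolding g0_def by (rule someI)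
  qed
  have classD: "y \<in> carrier G" "y \<notin> Z" if "y \<in> cent_class x" for y using that by (auto simp: cent_class_def)
  let ?F = "\<lambda>(g,c). (conj g c, inv (g0 (conj g c)) \<otimes> g)"
  let ?F' = "\<lambda>(y,m). (g0 y \<otimes> m, conj (inv m) (conj (inv (g0 y)) y))"
  have to_class: "conj g c \<in> cent_class x" if "g \<in> carrier G" "c \<in> cent x" "c \<notin> Z" for g c
  proof -
    have "conj (inv g) (conj g c) \<in> cent x" using that by (simp add: cent_carrier)
    then have "\<exists>k\<in>carrier G. conj k (conj g c) \<in> cent x" using that by blast
    then show ?thesis using that by (simp add: cent_class_def conj_Z_iff cent_carrier)
  qed
  have "bij_betw ?F (carrier G \<times> (cent x - Z)) (cent_class x \<times> cent_normalizer x)"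
  proof (rule bij_betw_byWitness[where f' = ?F'])
    show "\<forall>a\<in>carrier G \<times> (cent x - Z). ?F' (?F a) = a"
    proof
      fix a assume "a \<in> carrier G \<times> (cent x - Z)"
      then obtain g c where a: "a = (g,c)" and *: "g \<in> carrier G" "c \<in> cent x" "c \<notin> Z" by blast
      let ?k = "g0 (conj g c)"
      have k: "?k \<in> carrier G" using g0[OF to_class[OF *]] by simp
      have c: "c \<in> carrier G" using * by (simp add: cent_carrier)
      have "?k \<otimes> (inv ?k \<otimes> g) = g" using k * by (simp flip: m_assoc)
      moreover have "conj (inv (inv ?k \<otimes> g)) (conj (inv ?k) (conj g c)) = c"
        using k * c by (simp add: conj_mult inv_mult_group)
      ultimately show "?F' (?F a) = a" unfolding a prod.case by simp
    qed
    show "\<forall>a\<in>cent_class x \<times> cent_normalizer x. ?F (?F' a) = a"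
    proof
      fix a assume "a \<in> cent_class x \<times> cent_normalizer x"
      then obtain y m where a: "a = (y,m)" and *: "y \<in> cent_class x" "m \<in> cent_normalizer x" by blast
      have k: "g0 y \<in> carrier G" and y: "y \<in> carrier G" and m: "m \<in> carrier G"
        using g0 * classD by (auto simp: cent_normalizer_def)
      have "conj (g0 y \<otimes> m) (conj (inv m) (conj (inv (g0 y)) y)) = y"
        using k y m by (simp add: conj_mult)
      then show "?F (?F' a) = a" unfolding a prod.case using k m by (simp flip: m_assoc)
    qed
    show "?F ` (carrier G \<times> (cent x - Z)) \<subseteq> cent_class x \<times> cent_normalizer x"
    proof
      fix b assume "b \<in> ?F ` (carrier G \<times> (cent x - Z))"
      then obtain g c where b: "b = ?F (g,c)" and *: "g \<in> carrier G" "c \<in> cent x" "c \<notin> Z" by blast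
      let ?k = "g0 (conj g c)" let ?m = "inv ?k \<otimes> g"
      have y: "conj g c \<in> cent_class x" using to_class * by blast
      have k: "?k \<in> carrier G" and c': "conj (inv ?k) (conj g c) \<in> cent x" using g0[OF y] by auto
      have c: "c \<in> carrier G" using * by (simp add: cent_carrier)
      have m: "?m \<in> carrier G" using k * by simp
      \<comment> \<open>\<open>conj ?m x\<close> commutes with the noncentral
        \<open>conj ?m c\<close>, which commutes with \<open>x\<close>; transitivity then puts
        \<open>?m\<close> into the normaliser.\<close>
      have "conj ?m c \<in> cent x" using c' k * c by (simp add: conj_mult)
      moreover have "conj ?m x \<in> cent (conj ?m c)" using conj_cent[OF m c] cent_sym[OF x(1)] * by blast
      moreover have "conj ?m c \<notin> Z" using * c m conj_Z_iff by blast
      ultimately have "conj ?m x \<in> cent x" using cent_trans x by blast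
      then show "b \<in> cent_class x \<times> cent_normalizer x" unfolding b prod.case using y m by (simp add: cent_normalizer_def)
    qed
    show "?F' ` (cent_class x \<times> cent_normalizer x) \<subseteq> carrier G \<times> (cent x - Z)"
    proof
      fix b assume "b \<in> ?F' ` (cent_class x \<times> cent_normalizer x)"
      then obtain y m where b: "b = ?F' (y,m)" and *: "y \<in> cent_class x" "m \<in> cent_normalizer x" by blast
      let ?c = "conj (inv (g0 y)) y"
      have k: "g0 y \<in> carrier G" and y: "y \<in> carrier G" "y \<notin> Z" and m: "m \<in> carrier G"
        and c: "?c \<in> cent x" and mx: "conj m x \<in> cent x" using g0 * classD by (auto simp: cent_normalizer_def)
      have cG: "?c \<in> carrier G" "?c \<notin> Z" using k y conj_Z_iff by auto
      have "?c \<in> cent (conj m x)"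
        using cent_trans[of "conj m x" x ?c] x m c cent_sym[OF x(1) mx] by simp
      then have "conj (inv m) ?c \<in> cent x" using conj_cent[of "inv m" "conj m x" ?c] m x by simp
      then show "b \<in> carrier G \<times> (cent x - Z)"
        unfolding b prod.case using k m cG by (simp add: conj_Z_iff)
    qed
  qed
  then have "card (carrier G \<times> (cent x - Z)) = card (cent_class x \<times> cent_normalizer x)"
    by (rule bij_betw_same_card)
  then show ?thesis
    using card_Diff_subset[OF _ Z_cent[OF x(1)]] finite_subset[OF Z_cent[OF x(1)] finite_sub(1)]
    by (simp add: card_cartesian_product)
qed

text \<open>A common element has a conjugate in \<open>cent x\<close> and one in
  \<open>cent y\<close>. Moving the latter onto the former carries \<open>y\<close> to an element
  that commutes with a noncentral member of \<open>cent x\<close>, hence into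
  \<open>cent x\<close>.\<close>

lemma cent_class_disjoint:
  assumes "x \<in> carrier G" "y \<in> carrier G" "y \<notin> Z" "y \<notin> cent_class x"
  shows "cent_class x \<inter> cent_class y = {}"
proof (rule ccontr)
  assume "cent_class x \<inter> cent_class y \<noteq> {}"
  then obtain w g k where w: "w \<in> carrier G" "w \<notin> Z" "g \<in> carrier G" "k \<in> carrier G"
    "conj g w \<in> cent x" "conj k w \<in> cent y" by (auto simp: cent_class_def)
  let ?m = "g \<otimes> inv k"
  have m: "?m \<in> carrier G" using w by simp
  have "conj ?m (conj k w) = conj g w" using w by (simp add: conj_mult)
  then have "conj ?m y \<in> cent (conj g w)"
    using conj_cent[OF m _ cent_sym[OF assms(2) w(6)]] w by simp
  then have "conj ?m y \<in> cent x" using cent_trans[of x "conj g w"] w assms by (simp add: conj_Z_iff)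
  then show False using assms m by (auto simp: cent_class_def)
qed

lemma card_Z_pos: "card Z > 0"
  using subgroup.one_closed[OF subgroup_Z] finite_subset[OF _ finite_G] Z_carrier
  by (metis card_gt_0_iff empty_iff subsetI)

text \<open>\<open>a\<close> is the index of \<open>Z\<close> in \<open>cent x\<close> and
  \<open>e\<close> the index of \<open>cent x\<close> in its normaliser; the double count
  \<open>card_cent_class\<close> is divided by \<open>card Z\<close>.\<close>

lemma cent_class_ratio:
  assumes x: "x \<in> carrier G" "x \<notin> Z"
  obtains a e :: nat where "a \<ge> 2" "e = 1 \<or> e = 2" "card (cent x) = a * card Z"
    "card (cent_normalizer x) = e * a * card Z"
    "real (card (cent_class x)) / card (carrier G) = (1 - 1 / a) / e"
proof -
  have sub: "subgroup Z (G\<lparr>carrier := cent x\<rparr>)"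
    using subgroup_incl[OF subgroup_Z subgroup_cent Z_cent] x by blast
  interpret C: group "G\<lparr>carrier := cent x\<rparr>"
    using subgroup.subgroup_is_group[OF subgroup_cent[OF x(1)]] is_group by blast
  have "card (rcosets\<^bsub>G\<lparr>carrier := cent x\<rparr>\<^esub> Z) * card Z = card (cent x)"
    using C.lagrange[OF sub] by (simp add: order_def)
  then obtain a where a: "card (cent x) = a * card Z" by metis
  have "Z \<subset> cent x" using Z_cent x by (auto simp: cent_def)
  then have "card Z < card (cent x)" by (simp add: psubset_card_mono finite_sub)
  then have "a \<noteq> 0" "a \<noteq> 1" using a by (metis not_less0 mult_0, metis less_irrefl mult_1)
  then have a2: "a \<ge> 2" by linarith
  obtain e where e: "e = 1 \<or> e = 2" "card (cent_normalizer x) = e * a * card Z"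
    using card_cent_normalizer[OF x] a by (metis mult.assoc mult_1)
  have n: "card (carrier G) > 0" using x finite_G by (auto simp: card_gt_0_iff)
  have "card (cent_class x) * (e * a * card Z) = card (carrier G) * ((a - 1) * card Z)"
    using card_cent_class[OF x] e a by (simp add: diff_mult_distrib)
  then have "card (cent_class x) * (e * a) = card (carrier G) * (a - 1)" using card_Z_pos by simp
  then have "real (card (cent_class x)) * (e * a) = card (carrier G) * (real a - 1)"
    using a2 by (metis One_nat_def Suc_1 Suc_leD of_nat_1 of_nat_diff of_nat_mult)
  then have "real (card (cent_class x)) / card (carrier G) = (1 - 1 / a) / e"
    using n a2 e(1) by (auto simp: field_simps)
  then show ?thesis using that a2 e a by blast
qed

text \<open>The proportions \<open>\<rho>\<close> of the classes add up to \<open>1 - 1/n\<close>. If \<open>cent_normalizer h\<close> is not all of \<open>G\<close>,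
  the gap that the class of \<open>h\<close> leaves lies in \<open>(0, 1/4)\<close> or \<open>(1/2, 7/12)\<close>, which no sum of values in
  \<open>{1/4} \<union> [1/3, 1/2] \<union> [2/3, 1)\<close> meets.\<close>

theorem normalizes_large_centralizer:
  assumes h: "h \<in> carrier G" "h \<notin> Z" and large: "6 * card Z \<le> card (cent h)"
    and y: "y \<in> carrier G"
  shows "conj y h \<in> {h, inv h}"
proof (rule ccontr)
  assume contr: "conj y h \<notin> {h, inv h}"
  have "y \<notin> cent_normalizer h" using contr flip h y by (auto simp: cent_normalizer_def conj_def cent_def)
  then have "cent_normalizer h \<subset> carrier G" using y by (auto simp: cent_normalizer_def)
  then have lt: "card (cent_normalizer h) < card (carrier G)" by (simp add: psubset_card_mono finite_G)
  define N where "N = real (card (carrier G))"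
  define \<rho> where "\<rho> x = real (card (cent_class x)) / N" for x
  define n where "n = N / card Z"
  have Npos: "N > 0" using h finite_G by (auto simp: N_def card_gt_0_iff)
  then have npos: "n > 0" using card_Z_pos by (simp add: n_def)
  have finX: "finite (carrier G - Z)" using finite_G by simp
  have cardX: "real (card (carrier G - Z)) / N = 1 - 1 / n"
  proof -
    have "card (carrier G - Z) = card (carrier G) - card Z" "card Z \<le> card (carrier G)"
      using Z_carrier finite_G by (auto intro!: card_Diff_subset card_mono intro: finite_subset)
    then have "real (card (carrier G - Z)) = N - card Z" by (simp add: N_def of_nat_diff)
    then show ?thesis using Npos by (simp add: n_def field_simps)
  qed
  \<comment> \<open>For \<open>e = 1\<close> the proportion is 1/2 or at least 2/3; for
    \<open>e = 2\<close> it is 1/4 or lies between 1/3 and 1/2.\<close>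
  have vals: "\<rho> x = 1/4 \<or> 1/3 \<le> \<rho> x \<and> \<rho> x \<le> 1/2 \<or> 2/3 \<le> \<rho> x"
    if x: "x \<in> carrier G" "x \<notin> Z" for x
  proof -
    obtain a e :: nat where ae: "a \<ge> 2" "e = 1 \<or> e = 2" "\<rho> x = (1 - 1 / a) / e"
      using cent_class_ratio[OF x] unfolding \<rho>_def N_def by metis
    consider "a = 2" | "a \<ge> 3" using ae(1) by linarith
    then show ?thesis
    proof cases
      case 1 then show ?thesis using ae by auto
    next
      case 2
      then have "1 / real a \<le> 1 / 3" "1 / real a > 0" by (auto simp: field_simps)
      then show ?thesis using ae(2,3) by auto
    qed
  qed
  \<comment> \<open>With \<open>u = 1/a\<close> and \<open>v = 1/n\<close> the gap is
    \<open>u - v\<close> for \<open>e = 1\<close> and \<open>1/2 + u/2 - v\<close> for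
    \<open>e = 2\<close>. As the normaliser is proper, \<open>v\<close> is below \<open>u\<close> or
    \<open>u/2\<close> respectively, and \<open>a \<ge> 6\<close> bounds \<open>u\<close> by
    1/6.\<close>
  have gap: "0 < 1 - 1 / n - \<rho> h \<and> 1 - 1 / n - \<rho> h < 1/4
     \<or> 1/2 < 1 - 1 / n - \<rho> h \<and> 1 - 1 / n - \<rho> h < 7/12"
  proof -
    obtain a e :: nat where ae: "a \<ge> 2" "e = 1 \<or> e = 2" "card (cent h) = a * card Z"
      "card (cent_normalizer h) = e * a * card Z" "\<rho> h = (1 - 1 / a) / e"
      using cent_class_ratio[OF h] unfolding \<rho>_def N_def by metis
    have a6: "a \<ge> 6" using large ae(3) card_Z_pos by simp
    have "real (e * a * card Z) < N" using lt ae(4) unfolding N_def by (simp only: of_nat_less_iff)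
    then have "real e * real a < n" using card_Z_pos by (simp add: n_def pos_less_divide_eq)
    moreover have "real e * real a > 0" using a6 ae(2) by auto
    ultimately have less: "1 / n < 1 / (real e * real a)" by (simp add: frac_less2)
    define u v where "u = 1 / real a" and "v = 1 / n"
    have "u \<le> 1/6" "v > 0" using a6 npos by (auto simp: u_def v_def field_simps)
    moreover have "\<rho> h = 1 - u \<and> v < u \<or> \<rho> h = 1 / 2 - u / 2 \<and> v < u / 2"
      using ae(2,5) less by (auto simp: u_def v_def diff_divide_distrib)
    ultimately show ?thesis unfolding v_def[symmetric] by (elim disjE conjE) auto
  qed
  have class_sub: "cent_class x \<subseteq> carrier G - Z" for x by (auto simp: cent_class_def)
  have "cent_class h \<noteq> carrier G - Z" using gap cardX by (auto simp: \<rho>_def)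
  then obtain x1 where x1: "x1 \<in> carrier G" "x1 \<notin> Z" "x1 \<notin> cent_class h" using class_sub by blast
  have d1: "cent_class h \<inter> cent_class x1 = {}" using cent_class_disjoint h x1 by blast
  have c1: "real (card (cent_class h \<union> cent_class x1)) / N = \<rho> h + \<rho> x1"
    using d1 by (simp add: card_Un_disjoint finite_sub \<rho>_def add_divide_distrib)
  have le: "real (card A) / N \<le> 1 - 1 / n" if "A \<subseteq> carrier G - Z" for A
    using card_mono[OF finX that] Npos by (simp add: divide_right_mono flip: cardX)
  have "\<rho> h + \<rho> x1 \<le> 1 - 1 / n" using le[of "cent_class h \<union> cent_class x1"] class_sub c1 by simp
  \<comment> \<open>A further class takes at least 1/4, which rules out the small gap; a class of
    2/3 or more exceeds 7/12.\<close>
  then have gap': "1/2 < 1 - 1 / n - \<rho> h" "1 - 1 / n - \<rho> h < 7/12" and r1: "\<rho> x1 \<le> 1/2"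
    using gap vals[OF x1(1,2)] by auto
  have "cent_class h \<union> cent_class x1 \<noteq> carrier G - Z"
  proof
    assume "cent_class h \<union> cent_class x1 = carrier G - Z"
    then show False using c1 cardX gap' r1 by simp
  qed
  then obtain x2 where x2: "x2 \<in> carrier G" "x2 \<notin> Z" "x2 \<notin> cent_class h" "x2 \<notin> cent_class x1"
    using class_sub by blast
  have d2: "(cent_class h \<union> cent_class x1) \<inter> cent_class x2 = {}" using cent_class_disjoint h x1 x2 by blast
  have c2: "real (card (cent_class h \<union> cent_class x1 \<union> cent_class x2)) / N = \<rho> h + \<rho> x1 + \<rho> x2"
    using d2 c1 by (simp add: card_Un_disjoint finite_sub \<rho>_def add_divide_distrib)
  have "\<rho> h + \<rho> x1 + \<rho> x2 \<le> 1 - 1 / n"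
    using le[of "cent_class h \<union> cent_class x1 \<union> cent_class x2"] class_sub c2 by simp
  \<comment> \<open>Two values of which one is at least 1/3 would sum to at least 7/12.\<close>
  then have quarter: "\<rho> x1 = 1/4" "\<rho> x2 = 1/4"
    using gap' vals[OF x1(1,2)] vals[OF x2(1,2)] by auto
  \<comment> \<open>Two quarters do not fill a gap above 1/2, yet a third further class brings the
    sum to at least 3/4.\<close>
  have "cent_class h \<union> cent_class x1 \<union> cent_class x2 \<noteq> carrier G - Z"
  proof
    assume "cent_class h \<union> cent_class x1 \<union> cent_class x2 = carrier G - Z"
    then show False using c2 cardX gap' quarter by simp
  qed
  then obtain x3 where x3: "x3 \<in> carrier G" "x3 \<notin> Z" "x3 \<notin> cent_class h" "x3 \<notin> cent_class x1" "x3 \<notin> cent_class x2"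
    using class_sub by blast
  have d3: "(cent_class h \<union> cent_class x1 \<union> cent_class x2) \<inter> cent_class x3 = {}" using cent_class_disjoint h x1 x2 x3 by blast
  have "real (card (cent_class h \<union> cent_class x1 \<union> cent_class x2 \<union> cent_class x3)) / N = \<rho> h + \<rho> x1 + \<rho> x2 + \<rho> x3"
    using d3 c2 by (simp add: card_Un_disjoint finite_sub \<rho>_def add_divide_distrib)
  then have "\<rho> h + \<rho> x1 + \<rho> x2 + \<rho> x3 \<le> 1 - 1 / n"
    using le[of "cent_class h \<union> cent_class x1 \<union> cent_class x2 \<union> cent_class x3"] class_sub by simp
  then show False using gap' quarter vals[OF x3(1,2)] by auto
qed

end

section \<open>A criterion for a subgroup to be \<open>SL(2,p)\<close>\<close>

text \<open>\<open>transvection x y t\<close> is the transvection \<open>w \<mapsto> w + t * (y * w\<^sub>1 - x * w\<^sub>2) * (x, y)\<close>.\<close>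

definition transvection :: "int \<Rightarrow> int \<Rightarrow> int \<Rightarrow> int \<times> int \<times> int \<times> int" where
  "transvection x y t = (1 + t*x*y, - t*x*x, t*y*y, 1 - t*x*y)"

context odd_prime
begin

lemma red_transvection_carrier: "red p (transvection x y t) \<in> carrier (SL2 p)"
  unfolding transvection_def by (rule red_in_carrier) (simp add: algebra_simps)

lemma transvection_add: "transvection x y s \<star> transvection x y t = red p (transvection x y (s + t))"
  unfolding transvection_def SL2_mult red_simp by (simp add: algebra_simps)

lemma SL2_mult3:
  "(a,b,c,d) \<star> (a',b',c',d') \<star> (a'',b'',c'',d'') =
    red p ((a*a' + b * c')*a'' + (a*b' + b*d') * c'', (a*a' + b * c')*b'' + (a*b' + b*d')*d'',
           (c * a' + d * c')*a'' + (c * b' + d*d') * c'', (c * a' + d * c')*b'' + (c * b' + d*d')*d'')"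
  by (simp only: SL2_mult red_simp mod_lincomb)

text \<open>\<open>K\<close> contains the root subgroup of the line through
  \<open>(x, y)\<close>.\<close>

definition root_in where
  "root_in K x y \<longleftrightarrow> (\<forall>t. red p (transvection x y t) \<in> K)"

lemma red_eqI:
  "\<lbrakk>p dvd a - a'; p dvd b - b'; p dvd c - c'; p dvd d - d'\<rbrakk> \<Longrightarrow> red p (a,b,c,d) = red p (a',b',c',d')"
  by (simp add: mod_eq_iff)

lemma red_transvection_cong:
  assumes "p dvd x' - x" "p dvd y' - y" "p dvd t' - t"
  shows "red p (transvection x' y' t') = red p (transvection x y t)"
  unfolding transvection_def by (rule red_eqI; use assms in Groebner_Basis.algebra)

lemma root_in_cong: "\<lbrakk>root_in K x y; p dvd x' - x; p dvd y' - y\<rbrakk> \<Longrightarrow> root_in K x' y'"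
  using red_transvection_cong[of x' x y' y] by (metis root_in_def cancel_comm_monoid_add_class.diff_cancel dvd_0_right)

lemma root_in_scale: "root_in K x y \<Longrightarrow> root_in K (s*x) (s*y)"
proof -
  have "transvection (s*x) (s*y) t = transvection x y (t*s*s)" for t by (simp add: transvection_def algebra_simps)
  then show "root_in K x y \<Longrightarrow> root_in K (s*x) (s*y)" by (simp add: root_in_def)
qed

text \<open>Powers of a transvection multiply its parameter, and the multiples of a unit
  \<open>s\<close> exhaust the residues.\<close>

lemma root_in_if_transvection:
  assumes K: "subgroup K (SL2 p)" and s: "red p (transvection x y s) \<in> K" "\<not> p dvd s"
  shows "root_in K x y"
proof -
  have pow: "red p (transvection x y (int n * s)) \<in> K" for n
  proof (induction n)
    case 0
    have "red p (transvection x y 0) = \<one>\<^bsub>SL2 p\<^esub>" using p_gt_2 by (simp add: transvection_def SL2_one)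
    then show ?case using subgroup.one_closed[OF K] by simp
  next
    case (Suc n)
    have "red p (transvection x y (int n * s)) \<star> red p (transvection x y s) = red p (transvection x y (int (Suc n) * s))"
      by (simp add: mult_red transvection_add algebra_simps)
    then show ?case using subgroup.m_closed[OF K Suc s(1)] by simp
  qed
  obtain i where i: "p dvd s * i - 1" using inverse_mod s(2) by blast
  show ?thesis unfolding root_in_def
  proof
    fix t
    have "p dvd (t * i) mod p - t * i" by (simp add: mod_eq_iff[symmetric])
    then have "p dvd ((t * i) mod p) * s - t" using i by Groebner_Basis.algebra
    moreover have "(t * i) mod p \<ge> 0" using p_gt_2 by simp
    then have "int (nat ((t * i) mod p)) = (t * i) mod p" by simp
    ultimately show "red p (transvection x y t) \<in> K"
      using pow[of "nat ((t * i) mod p)"] red_transvection_cong[of x x y y] by simp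
  qed
qed

text \<open>Conjugation by a matrix of determinant 1 turns a transvection into the one along the
  image vector, with the same parameter.\<close>

lemma root_in_conj:
  assumes K: "subgroup K (SL2 p)" and g: "(a,b,c,d) \<in> K" and r: "root_in K x y"
  shows "root_in K (a*x + b*y) (c*x + d*y)"
  unfolding root_in_def
proof
  fix t
  let ?u = "red p (transvection x y t)" let ?w = "red p (transvection (a*x + b*y) (c*x + d*y) t)"
  have gc: "(a,b,c,d) \<in> carrier (SL2 p)" using subgroup.mem_carrier[OF K g] .
  have u: "?u \<in> K" using r by (simp add: root_in_def)
  have D: "p dvd a*d - b * c - 1" using carrier_dvd[OF gc] .
  have "red p (?w \<star> (a,b,c,d)) = red p ((a,b,c,d) \<star> ?u)"
    unfolding mult_red unfolding transvection_def SL2_mult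
    by (simp only: prod.inject mod_eq_iff; intro conjI; use D in Groebner_Basis.algebra)
  then have "?w \<star> (a,b,c,d) = (a,b,c,d) \<star> ?u" by (simp only: mult_red)
  then have "?w = (a,b,c,d) \<star> ?u \<star> inv\<^bsub>SL2 p\<^esub> (a,b,c,d)"
    using gc red_transvection_carrier by (metis inv_solve_right m_closed)
  then show "?w \<in> K" using u g K by (metis subgroup.m_closed subgroup.m_inv_closed)
qed

text \<open>A transvection along \<open>(x, y)\<close> shifts \<open>(x', y')\<close> by any
  multiple of \<open>(x, y)\<close>, so up to scaling every other direction is an image of
  \<open>(x', y')\<close>.\<close>

lemma root_in_all:
  assumes K: "subgroup K (SL2 p)" and r: "root_in K x y" "root_in K x' y'"
    and ind: "\<not> p dvd x * y' - x' * y"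
  shows "root_in K u v"
proof -
  obtain i where i: "p dvd (x*y' - x'*y) * i - 1" using inverse_mod ind by blast
  \<comment> \<open>Cramer's rule for the coordinates of \<open>(u, v)\<close> in the basis
    \<open>(x, y)\<close>, \<open>(x', y')\<close>.\<close>
  define \<alpha> \<beta> where "\<alpha> = (u*y' - v*x') * i" and "\<beta> = (x*v - y*u) * i"
  have u: "p dvd u - (\<alpha>*x + \<beta>*x')" and v: "p dvd v - (\<alpha>*y + \<beta>*y')"
    using i unfolding \<alpha>_def \<beta>_def by Groebner_Basis.algebra+
  show ?thesis
  proof (cases "p dvd \<beta>")
    case True
    then have "p dvd u - \<alpha>*x" "p dvd v - \<alpha>*y" using u v by Groebner_Basis.algebra+
    then show ?thesis using root_in_cong[OF root_in_scale[OF r(1)]] by blast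
  next
    case False
    then obtain j where j: "p dvd \<beta> * j - 1" using inverse_mod by blast
    \<comment> \<open>Chosen so that the transvection moves \<open>(x', y')\<close> by
      \<open>\<alpha>/\<beta>\<close> times \<open>(x, y)\<close>; the factor \<open>i\<close>
      cancels the determinant.\<close>
    define s where "s = - \<alpha> * i * j"
    have "red p (transvection x y s) \<in> K" using r(1) by (simp add: root_in_def)
    then obtain a b c d where g: "(a,b,c,d) \<in> K" and e: "(a,b,c,d) = red p (transvection x y s)"
      by (metis prod_cases4)
    have "p dvd a - (1 + s*x*y)" "p dvd b - (- s*x*x)" "p dvd c - s*y*y" "p dvd d - (1 - s*x*y)"
      using e by (simp_all only: transvection_def red_simp prod.inject mod_eq_iff[symmetric] mod_mod_trivial)
    then have "p dvd u - \<beta> * (a*x' + b*y')" "p dvd v - \<beta> * (c*x' + d*y')"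
      using u v i j unfolding s_def by Groebner_Basis.algebra+
    then show ?thesis using root_in_cong[OF root_in_scale[OF root_in_conj[OF K g r(2)]]] by blast
  qed
qed

text \<open>Bruhat decomposition: if the lower left entry is a unit, the matrix is a product of an
  upper, a lower and an upper unitriangular one. Otherwise adding the first row to the second makes
  that entry a unit.\<close>

lemma all_if_transvections:
  assumes K: "subgroup K (SL2 p)" and r: "root_in K 1 0" "root_in K 0 1"
  shows "K = carrier (SL2 p)"
proof
  show "K \<subseteq> carrier (SL2 p)" using subgroup.subset[OF K] .
  have U: "red p (1,t,0,1) \<in> K" and L: "red p (1,0,t,1) \<in> K" for t
    using r[unfolded root_in_def transvection_def, rule_format, of "-t"]
      r[unfolded root_in_def transvection_def, rule_format, of t] by simp_all
  have main: "(a,b,c,d) \<in> K" if g: "(a,b,c,d) \<in> carrier (SL2 p)" and c: "\<not> p dvd c" for a b c d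
  proof -
    obtain i where i: "p dvd c * i - 1" using inverse_mod c by blast
    have D: "p dvd a*d - b * c - 1" using carrier_dvd[OF g] .
    let ?A = "red p (1,(a-1)*i,0,1)" let ?B = "red p (1,0,c,1)" let ?C = "red p (1,(d-1)*i,0,1)"
    have "p dvd 1 + (a-1)*i * c - a" "p dvd (1 + (a-1)*i * c)*((d-1)*i) + (a-1)*i - b"
      "p dvd c * ((d-1)*i) + 1 - d"
      using i D by Groebner_Basis.algebra+
    then have "?A \<star> ?B \<star> ?C = red p (a,b,c,d)"
      unfolding mult_red SL2_mult3 by (intro red_eqI) simp_all
    then have "?A \<star> ?B \<star> ?C = (a,b,c,d)" using red_carrier[OF g] by (simp only:)
    then show ?thesis using U L subgroup.m_closed[OF K] by metis
  qed
  show "carrier (SL2 p) \<subseteq> K"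
  proof
    fix m assume m: "m \<in> carrier (SL2 p)"
    obtain a b c d where e: "m = (a,b,c,d)" by (cases m)
    show "m \<in> K"
    proof (cases "p dvd c")
      case False then show ?thesis using main m e by blast
    next
      case True
      let ?L = "red p (1,0,1,1)"
      have D: "p dvd a*d - b * c - 1" using carrier_dvd m e by blast
      have "\<not> p dvd a"
      proof
        assume "p dvd a"
        then have "p dvd 1" using D True by Groebner_Basis.algebra
        then show False using p_gt_2 by (auto dest: zdvd_imp_le)
      qed
      then have "\<not> p dvd (a + c) mod p" using True by (simp add: dvd_mod_iff dvd_add_left_iff)
      moreover have Lm: "?L \<star> m = (a mod p, b mod p, (a + c) mod p, (b + d) mod p)"
        unfolding e mult_red SL2_mult by (simp add: algebra_simps)
      moreover have "?L \<star> m \<in> carrier (SL2 p)" using m L subgroup.mem_carrier[OF K] by blast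
      ultimately have "?L \<star> m \<in> K" using main by metis
      moreover have "m = inv\<^bsub>SL2 p\<^esub> ?L \<star> (?L \<star> m)"
        using m L subgroup.mem_carrier[OF K] by (metis inv_solve_left m_closed)
      ultimately show ?thesis using L K by (metis subgroup.m_closed subgroup.m_inv_closed)
    qed
  qed
qed

section \<open>Unipotent elements and the subgroups that contain them\<close>

lemma centre_elements: "\<one>\<^bsub>SL2 p\<^esub> \<in> centre_SL2 p" "(p-1,0,0,p-1) \<in> centre_SL2 p"
  by (simp_all add: centre_SL2_def SL2_one)

lemma minus_one_mult: "(p-1,0,0,p-1) \<star> (a,b,c,d) = red p (-a,-b,-c,-d)"
  by (simp add: SL2_mult mod_eq_iff algebra_simps)

text \<open>Determinant 1 and trace 2 make \<open>g - 1\<close> square to zero, so \<open>g\<close>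
  is a transvection along the image of \<open>g - 1\<close>. This is spanned by
  \<open>(b, 1 - a)\<close> if \<open>b\<close> is a unit and by \<open>(0, 1)\<close>
  otherwise.\<close>

lemma unipotent_root:
  assumes K: "subgroup K (SL2 p)" and g: "(a,b,c,d) \<in> K"
    and nc: "\<not> (p dvd b \<and> p dvd c \<and> p dvd a - d)" and tr: "p dvd a + d - 2"
  shows "\<exists>x y. \<not> (p dvd x \<and> p dvd y) \<and> root_in K x y"
proof -
  have gc: "(a,b,c,d) \<in> carrier (SL2 p)" using subgroup.mem_carrier[OF K g] .
  have D: "p dvd a*d - b * c - 1" using carrier_dvd[OF gc] .
  have "\<not> p dvd 1" using p_gt_2 by (auto dest: zdvd_imp_le)
  show ?thesis
  proof (cases "p dvd b")
    case False
    then obtain i where i: "p dvd b * i - 1" using inverse_mod by blast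
    have "red p (transvection b (1-a) (-i)) = red p (a,b,c,d)"
      unfolding transvection_def by (rule red_eqI; use D i tr in Groebner_Basis.algebra)
    then have "red p (transvection b (1-a) (-i)) \<in> K" using g red_carrier[OF gc] by simp
    moreover have "\<not> p dvd -i"
    proof
      assume "p dvd -i" then have "p dvd 1" using i by Groebner_Basis.algebra
      then show False using \<open>\<not> p dvd 1\<close> by blast
    qed
    ultimately show ?thesis using root_in_if_transvection[OF K] False by blast
  next
    case True
    then have "p dvd (a-1)*(a-1)" using D tr by Groebner_Basis.algebra
    then have a: "p dvd a - 1" by (simp add: p_dvd_mult_iff)
    then have "p dvd a - d" using tr by Groebner_Basis.algebra
    then have c: "\<not> p dvd c" using nc True by blast
    have "p dvd 1 - a" "p dvd 1 - d" using a tr by Groebner_Basis.algebra+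
    then have "red p (transvection 0 1 c) = red p (a,b,c,d)"
      unfolding transvection_def by (intro red_eqI) (use True in simp_all)
    then have "red p (transvection 0 1 c) \<in> K" using g red_carrier[OF gc] by simp
    then show ?thesis using root_in_if_transvection[OF K _ c] \<open>\<not> p dvd 1\<close> by blast
  qed
qed

text \<open>\<open>irr\<close> says that \<open>K\<close> fixes no line, through the determinant of
  a vector and its image. Up to the central sign \<open>g\<close> has trace 2, so \<open>K\<close>
  contains one root subgroup, and moving its line gives a second.\<close>

lemma all_if_unipotent:
  assumes K: "subgroup K (SL2 p)" and Z: "centre_SL2 p \<subseteq> K"
    and irr: "\<And>x y. \<not> (p dvd x \<and> p dvd y) \<Longrightarrow>
      \<exists>a b c d. (a,b,c,d) \<in> K \<and> \<not> p dvd x * (c*x + d*y) - (a*x + b*y) * y"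
    and g: "(a,b,c,d) \<in> K" and nc: "\<not> (p dvd b \<and> p dvd c \<and> p dvd a - d)"
    and tr: "p dvd (a + d) * (a + d) - 4"
  shows "K = carrier (SL2 p)"
proof -
  have "p dvd (a + d - 2) * (a + d + 2)" using tr by Groebner_Basis.algebra
  then consider "p dvd a + d - 2" | "p dvd a + d + 2" by (auto simp: p_dvd_mult_iff)
  then have "\<exists>x y. \<not> (p dvd x \<and> p dvd y) \<and> root_in K x y"
  proof cases
    case 1 then show ?thesis using unipotent_root[OF K g nc] by blast
  next
    case 2
    have "(p-1,0,0,p-1) \<star> (a,b,c,d) \<in> K" using subgroup.m_closed[OF K] Z centre_elements g by blast
    then have "((-a) mod p, (-b) mod p, (-c) mod p, (-d) mod p) \<in> K"
      by (simp add: minus_one_mult)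
    moreover have "p dvd (-a) mod p - (-a)" "p dvd (-d) mod p - (-d)"
      by (simp_all only: mod_eq_iff[symmetric] mod_mod_trivial)
    then have "p dvd (-a) mod p + (-d) mod p - 2" using 2 by Groebner_Basis.algebra
    moreover have "p dvd (-a) mod p - (-d) mod p \<longleftrightarrow> p dvd a - d"
      by (metis mod_eq_iff mod_mod_trivial mod_minus_cong minus_minus)
    ultimately show ?thesis using nc unipotent_root[OF K] by (simp add: dvd_mod_iff)
  qed
  then obtain x y where xy: "\<not> (p dvd x \<and> p dvd y)" "root_in K x y" by blast
  obtain a b c d where "(a,b,c,d) \<in> K" and m: "\<not> p dvd x * (c*x + d*y) - (a*x + b*y) * y"
    using irr[OF xy(1)] by blast
  then have "root_in K (a*x + b*y) (c*x + d*y)" using root_in_conj[OF K] xy(2) by blast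
  then have "root_in K u v" for u v using root_in_all[OF K xy(2)] m by blast
  then show ?thesis using all_if_transvections[OF K] by blast
qed

text \<open>Commuting means that the trace-free parts, with coordinates
  \<open>(b, c, a - d)\<close>, are parallel; the three conditions are the minors.\<close>

lemma commute_iff:
  "(a,b,c,d) \<star> (a',b',c',d') = (a',b',c',d') \<star> (a,b,c,d) \<longleftrightarrow>
    p dvd b * c' - b' * c \<and> p dvd b * (a' - d') - b' * (a - d) \<and> p dvd c * (a' - d') - c' * (a - d)"
proof -
  have "a*a' + b * c' - (a'*a + b' * c) = b * c' - b' * c" "c * b' + d*d' - (c' * b + d'*d) = - (b * c' - b' * c)"
    "a*b' + b*d' - (a'*b + b'*d) = - (b * (a' - d') - b' * (a - d))"
    "c * a' + d * c' - (c' * a + d' * c) = c * (a' - d') - c' * (a - d)"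
    by (simp_all add: algebra_simps)
  then show ?thesis unfolding SL2_mult prod.inject mod_eq_iff by (metis dvd_minus_iff)
qed

lemma subgroup_centre: "subgroup (centre_SL2 p) (SL2 p)"
proof (rule subgroupI)
  let ?m = "(p-1,0,0,p-1)"
  have "(- (p-1)) mod p = 1 mod p" by (simp add: mod_eq_iff)
  then have mm: "?m \<star> ?m = \<one>\<^bsub>SL2 p\<^esub>" using p_gt_2 by (simp add: minus_one_mult SL2_one)
  have "p dvd (p-1)*(p-1) - 0*0 - 1" by (simp add: algebra_simps)
  moreover have "(p-1) mod p = p-1" using p_gt_2 by (intro mod_pos_pos_trivial) auto
  ultimately have m: "?m \<in> carrier (SL2 p)" using red_in_carrier[of "p-1" "p-1" 0 0] by (simp only: red_simp mod_0)
  then show "centre_SL2 p \<subseteq> carrier (SL2 p)" using one_closed by (simp add: centre_SL2_def SL2_one)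
  have "inv\<^bsub>SL2 p\<^esub> ?m = ?m" using mm m by (intro inv_equality) auto
  then show "inv\<^bsub>SL2 p\<^esub> u \<in> centre_SL2 p" if "u \<in> centre_SL2 p" for u
    using that inv_one by (auto simp: centre_SL2_def SL2_one)
  show "u \<star> v \<in> centre_SL2 p" if "u \<in> centre_SL2 p" "v \<in> centre_SL2 p" for u v
  proof -
    have "u = \<one>\<^bsub>SL2 p\<^esub> \<or> u = ?m" "v = \<one>\<^bsub>SL2 p\<^esub> \<or> v = ?m"
      using that by (auto simp: centre_SL2_def SL2_one)
    then show ?thesis using mm m centre_elements by auto
  qed
qed (simp add: centre_SL2_def)

lemma centre_commutes: "z \<in> centre_SL2 p \<Longrightarrow> z \<star> x = x \<star> z"
  by (cases z; cases x) (auto simp: commute_iff centre_SL2_def)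

text \<open>Being parallel is transitive through a nonzero vector, and the trace-free part of a
  noncentral matrix is nonzero modulo \<open>p\<close>.\<close>

lemma centralizer_commutative:
  assumes y: "y \<in> carrier (SL2 p)" "y \<notin> centre_SL2 p" and "x \<star> y = y \<star> x" "y \<star> w = w \<star> y"
  shows "x \<star> w = w \<star> x"
proof -
  obtain a b c d where x: "x = (a,b,c,d)" by (cases x)
  obtain a' b' c' d' where y': "y = (a',b',c',d')" by (cases y)
  obtain a'' b'' c'' d'' where w: "w = (a'',b'',c'',d'')" by (cases w)
  note c1 = assms(3)[unfolded x y' commute_iff] and c2 = assms(4)[unfolded w y' commute_iff]
  let ?P = "\<lambda>m. p dvd m * (b * c'' - b'' * c) \<and> p dvd m * (b * (a'' - d'') - b'' * (a - d))
    \<and> p dvd m * (c * (a'' - d'') - c'' * (a - d))"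
  have "?P b'" "?P c'" "?P (a' - d')" by (intro conjI; use c1 c2 in Groebner_Basis.algebra)+
  moreover have "\<not> p dvd b' \<or> \<not> p dvd c' \<or> \<not> p dvd a' - d'" using y centre_iff y' by blast
  ultimately show ?thesis unfolding x w commute_iff p_dvd_mult_iff by blast
qed

text \<open>Conjugation preserves trace and determinant, hence the quadratic form of the trace-free
  part. A parallel vector with the same nonzero value is the vector itself or its negative, and the
  negative belongs to the inverse.\<close>

lemma conj_flip:
  assumes x: "x \<in> carrier (SL2 p)" and y: "y \<in> carrier (SL2 p)"
    and xe: "x = (a,b,c,d)" and tr: "\<not> p dvd (a + d) * (a + d) - 4"
    and comm: "(y \<star> x \<star> inv\<^bsub>SL2 p\<^esub> y) \<star> x = x \<star> (y \<star> x \<star> inv\<^bsub>SL2 p\<^esub> y)"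
  shows "y \<star> x \<star> inv\<^bsub>SL2 p\<^esub> y \<in> {x, inv\<^bsub>SL2 p\<^esub> x}"
proof -
  obtain r s t u where ye: "y = (r,s,t,u)" by (cases y)
  let ?z = "y \<star> x \<star> inv\<^bsub>SL2 p\<^esub> y"
  have zc: "?z \<in> carrier (SL2 p)" using x y by simp
  obtain a' b' c' d' where ze: "?z = (a',b',c',d')" by (cases ?z)
  have zc': "(a',b',c',d') \<in> carrier (SL2 p)" using zc ze by simp
  have Dx: "p dvd a*d - b * c - 1" and Dy: "p dvd r*u - s*t - 1" and Dz: "p dvd a'*d' - b' * c' - 1"
    using carrier_dvd x y zc' xe ye by blast+
  have invy: "inv\<^bsub>SL2 p\<^esub> y = red p (u,-s,-t,r)" using inv_SL2 y ye by blast
  have "(a',b',c',d') = (r,s,t,u) \<star> (a,b,c,d) \<star> (u,-s,-t,r)"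
    using ze unfolding invy mult_red unfolding xe ye by simp
  then have "p dvd a' - ((r*a + s * c)*u + (r*b + s*d)*(-t))"
    "p dvd d' - ((t*a + u * c)*(-s) + (t*b + u*d)*r)"
    by (simp_all only: SL2_mult3 red_simp prod.inject mod_eq_iff[symmetric] mod_mod_trivial)
  then have T: "p dvd a' + d' - (a + d)" using Dy by Groebner_Basis.algebra
  note C = comm[unfolded ze, unfolded xe commute_iff]
  \<comment> \<open>Modulo \<open>p\<close>, \<open>?Q\<close> is the form
    \<open>(a - d)^2 + 4 * b * c\<close>, and \<open>?B\<close> is its polar form between
    \<open>x\<close> and its conjugate. For parallel vectors with equal values, \<open>?B\<close>
    and \<open>?Q\<close> have the same square.\<close>
  let ?Q = "(a + d) * (a + d) - 4"
  let ?B = "(a - d)*(a' - d') + 2*(b * c' + c * b')"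
  have "p dvd (?B - ?Q) * (?B + ?Q)" using C Dx Dz T by Groebner_Basis.algebra
  moreover have not2: "\<not> p dvd 2" using p_gt_2 by (auto dest: zdvd_imp_le)
  moreover have P: "p dvd ?Q * b' - ?B * b" "p dvd ?Q * c' - ?B * c" "p dvd ?Q * (a' - d') - ?B * (a - d)"
    using C Dx by Groebner_Basis.algebra+
  moreover have par1: "p dvd q * (v - u)" if "p dvd q * v - b * u" "p dvd b - q" for q b u v :: int
    using that by Groebner_Basis.algebra
  moreover have par2: "p dvd q * (v + u)" if "p dvd q * v - b * u" "p dvd b + q" for q b u v :: int
    using that by Groebner_Basis.algebra
  ultimately consider "p dvd ?B - ?Q" | "p dvd ?B + ?Q" by (auto simp: p_dvd_mult_iff)
  then show ?thesis
  proof cases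
    case 1
    have "p dvd ?Q * (b' - b)" "p dvd ?Q * (c' - c)" "p dvd ?Q * ((a' - d') - (a - d))"
      using par1[OF P(1) 1] par1[OF P(2) 1] par1[OF P(3) 1] by blast+
    then have "p dvd b' - b" "p dvd c' - c" and A: "p dvd (a' - d') - (a - d)"
      using tr by (auto simp: p_dvd_mult_iff)
    moreover have "p dvd 2 * (a' - a)" "p dvd 2 * (d' - d)" using A T by Groebner_Basis.algebra+
    then have "p dvd a' - a" "p dvd d' - d" using not2 by (simp_all only: p_dvd_mult_iff simp_thms)
    ultimately have "(a',b',c',d') = (a,b,c,d)" using eq_if_dvd[OF zc'] x xe by blast
    then show ?thesis using ze xe by simp
  next
    case 2
    have "p dvd ?Q * (b' + b)" "p dvd ?Q * (c' + c)" "p dvd ?Q * ((a' - d') + (a - d))"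
      using par2[OF P(1) 2] par2[OF P(2) 2] par2[OF P(3) 2] by blast+
    then have B: "p dvd b' + b" "p dvd c' + c" and A: "p dvd (a' - d') + (a - d)"
      using tr by (auto simp: p_dvd_mult_iff)
    have "p dvd 2 * (a' - d)" "p dvd 2 * (d' - a)" using A T by Groebner_Basis.algebra+
    then have "p dvd a' - d" "p dvd d' - a" using not2 by (simp_all only: p_dvd_mult_iff simp_thms)
    then have "red p (a',b',c',d') = red p (d,-b,-c,a)" by (intro red_eqI) (use B in simp_all)
    then show ?thesis using ze red_carrier[OF zc'] inv_SL2 x xe by simp
  qed
qed

text \<open>The products of the two central elements with the powers of \<open>h\<close> below
  \<open>n\<close> are distinct, since a coincidence would make a positive power below
  \<open>n\<close> central.\<close>

lemma card_centralizer_ge: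
  assumes K: "subgroup K (SL2 p)" and Z: "centre_SL2 p \<subseteq> K" and h: "h \<in> K"
    and pow: "\<And>d. 0 < d \<Longrightarrow> d < n \<Longrightarrow> h [^]\<^bsub>SL2 p\<^esub> d \<notin> centre_SL2 p"
  shows "2 * n \<le> card {y \<in> K. y \<star> h = h \<star> y}"
proof -
  let ?f = "\<lambda>(m::nat,z). z \<star> h [^]\<^bsub>SL2 p\<^esub> m"
  have hc: "h \<in> carrier (SL2 p)" using subgroup.mem_carrier[OF K h] .
  have Zc: "z \<in> carrier (SL2 p)" if "z \<in> centre_SL2 p" for z
    using subgroup.mem_carrier[OF subgroup_centre that] .
  have le: "m = m' \<and> z = z'" if "m \<le> m'" "m' < n" "z \<in> centre_SL2 p" "z' \<in> centre_SL2 p"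
    "z \<star> h [^]\<^bsub>SL2 p\<^esub> m = z' \<star> h [^]\<^bsub>SL2 p\<^esub> m'" for m m' z z'
  proof -
    let ?d = "m' - m"
    have "h [^]\<^bsub>SL2 p\<^esub> m' = h [^]\<^bsub>SL2 p\<^esub> ?d \<star> h [^]\<^bsub>SL2 p\<^esub> m"
      using nat_pow_mult[OF hc, of ?d m] that(1) by simp
    then have "z \<star> h [^]\<^bsub>SL2 p\<^esub> m = (z' \<star> h [^]\<^bsub>SL2 p\<^esub> ?d) \<star> h [^]\<^bsub>SL2 p\<^esub> m"
      using that(5) by (simp add: SL2_assoc)
    then have eq: "z = z' \<star> h [^]\<^bsub>SL2 p\<^esub> ?d" using hc Zc that by (simp add: r_cancel)
    then have "h [^]\<^bsub>SL2 p\<^esub> ?d = inv\<^bsub>SL2 p\<^esub> z' \<star> z" using hc Zc that by (simp add: inv_solve_left)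
    then have "h [^]\<^bsub>SL2 p\<^esub> ?d \<in> centre_SL2 p"
      using subgroup_centre that by (metis subgroup.m_closed subgroup.m_inv_closed)
    then have "?d = 0" using pow[of ?d] that(2) by linarith
    then show ?thesis using eq that(1,4) Zc by simp
  qed
  have "inj_on ?f ({..<n} \<times> centre_SL2 p)"
  proof (rule inj_onI, clarify)
    fix m z m' z' assume "m < n" "m' < n" "z \<in> centre_SL2 p" "z' \<in> centre_SL2 p"
      "z \<star> h [^]\<^bsub>SL2 p\<^esub> m = z' \<star> h [^]\<^bsub>SL2 p\<^esub> m'"
    then show "m = m' \<and> z = z'" using le[of m m' z z'] le[of m' m z' z] by (metis nat_le_linear)
  qed
  then have "card (?f ` ({..<n} \<times> centre_SL2 p)) = n * card (centre_SL2 p)"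
    by (simp add: card_image card_cartesian_product)
  moreover have "card (centre_SL2 p) = 2" using p_gt_2 by (simp add: centre_SL2_def)
  ultimately have card: "card (?f ` ({..<n} \<times> centre_SL2 p)) = n * 2" by (simp only:)
  have sub: "?f ` ({..<n} \<times> centre_SL2 p) \<subseteq> {y \<in> K. y \<star> h = h \<star> y}"
  proof
    fix y assume "y \<in> ?f ` ({..<n} \<times> centre_SL2 p)"
    then obtain a where a: "y = ?f a" "a \<in> {..<n} \<times> centre_SL2 p" by blast
    obtain m z where mz: "a = (m,z)" by (rule prod.exhaust)
    have y: "y = z \<star> h [^]\<^bsub>SL2 p\<^esub> m" and z: "z \<in> centre_SL2 p" using a unfolding mz by simp_all
    have "h [^]\<^bsub>SL2 p\<^esub> m \<in> K"
      by (induction m) (use K h in \<open>simp_all add: subgroup.one_closed subgroup.m_closed\<close>)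
    moreover have "h [^]\<^bsub>SL2 p\<^esub> m \<star> h = h \<star> h [^]\<^bsub>SL2 p\<^esub> m"
      using nat_pow_Suc2[OF hc] nat_pow_Suc by metis
    ultimately have "y \<in> K" "y \<star> h = h \<star> y"
      using z Z centre_commutes[OF z, of h] subgroup.m_closed[OF K]
      unfolding y by (blast, metis SL2_assoc)
    then show "y \<in> {y \<in> K. y \<star> h = h \<star> y}" by blast
  qed
  have "finite {y \<in> K. y \<star> h = h \<star> y}"
    by (rule finite_subset[OF _ finite_SL2]) (use subgroup.subset[OF K] in blast)
  from card_mono[OF this sub] show ?thesis by (simp only: card mult.commute)
qed

text \<open>Were \<open>K\<close> proper, \<open>all_if_unipotent\<close> would exclude noncentral
  elements of trace 2 or -2, and \<open>K\<close> would satisfy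
  \<open>commutation_transitive\<close>. As the centre has order 2, 12 is the bound of
  \<open>normalizes_large_centralizer\<close>, whose conclusion \<open>y\<close> violates.\<close>

theorem subgroup_SL2_eq:
  assumes K: "subgroup K (SL2 p)" and Z: "centre_SL2 p \<subseteq> K"
    and irr: "\<And>x y. \<not> (p dvd x \<and> p dvd y) \<Longrightarrow>
      \<exists>a b c d. (a,b,c,d) \<in> K \<and> \<not> p dvd x * (c*x + d*y) - (a*x + b*y) * y"
    and h: "h \<in> K" "h \<notin> centre_SL2 p" and large: "12 \<le> card {y \<in> K. y \<star> h = h \<star> y}"
    and y: "y \<in> K" "y \<star> h \<star> inv\<^bsub>SL2 p\<^esub> y \<notin> {h, inv\<^bsub>SL2 p\<^esub> h}"
  shows "K = carrier (SL2 p)"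
proof (rule ccontr)
  assume ne: "K \<noteq> carrier (SL2 p)"
  let ?G = "SL2 p\<lparr>carrier := K\<rparr>"
  have Kc: "x \<in> carrier (SL2 p)" if "x \<in> K" for x using subgroup.mem_carrier[OF K that] .
  have invK: "inv\<^bsub>?G\<^esub> x = inv\<^bsub>SL2 p\<^esub> x" if "x \<in> K" for x
    using m_inv_consistent[OF K that] .
  have G: "group ?G" using subgroup.subgroup_is_group[OF K group_SL2] .
  interpret T: commutation_transitive ?G "centre_SL2 p"
  proof (intro commutation_transitive.intro commutation_transitive_axioms.intro)
    show "group ?G" by (rule G)
    show "finite (carrier ?G)" using finite_SL2 Kc by (simp, metis finite_subset subsetI)
    show "subgroup (centre_SL2 p) ?G" using subgroup_incl[OF subgroup_centre K Z] .
  next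
    fix z x assume "z \<in> centre_SL2 p" "x \<in> carrier ?G"
    then show "z \<otimes>\<^bsub>?G\<^esub> x = x \<otimes>\<^bsub>?G\<^esub> z"
      by (simp add: centre_commutes)
  next
    fix x y w assume "x \<in> carrier ?G" "y \<in> carrier ?G" "w \<in> carrier ?G" "y \<notin> centre_SL2 p"
      "x \<otimes>\<^bsub>?G\<^esub> y = y \<otimes>\<^bsub>?G\<^esub> x" "y \<otimes>\<^bsub>?G\<^esub> w = w \<otimes>\<^bsub>?G\<^esub> y"
    then show "x \<otimes>\<^bsub>?G\<^esub> w = w \<otimes>\<^bsub>?G\<^esub> x" using centralizer_commutative[of y x w] Kc by simp
  next
    fix x y assume *: "x \<in> carrier ?G" "x \<notin> centre_SL2 p" "y \<in> carrier ?G"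
      "(y \<otimes>\<^bsub>?G\<^esub> x \<otimes>\<^bsub>?G\<^esub> inv\<^bsub>?G\<^esub> y) \<otimes>\<^bsub>?G\<^esub> x = x \<otimes>\<^bsub>?G\<^esub> (y \<otimes>\<^bsub>?G\<^esub> x \<otimes>\<^bsub>?G\<^esub> inv\<^bsub>?G\<^esub> y)"
    obtain a b c d where xe: "x = (a,b,c,d)" by (cases x)
    have "\<not> p dvd (a + d) * (a + d) - 4"
    proof
      assume tr: "p dvd (a + d) * (a + d) - 4"
      have "(a,b,c,d) \<in> K" "\<not> (p dvd b \<and> p dvd c \<and> p dvd a - d)"
        using * xe centre_iff Kc by auto
      then show False using all_if_unipotent[OF K Z irr] tr ne by blast
    qed
    then show "y \<otimes>\<^bsub>?G\<^esub> x \<otimes>\<^bsub>?G\<^esub> inv\<^bsub>?G\<^esub> y \<in> {x, inv\<^bsub>?G\<^esub> x}"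
      using conj_flip[of x y] xe * Kc by (simp add: invK)
  qed
  have "card (centre_SL2 p) = 2" using p_gt_2 by (simp add: centre_SL2_def)
  then have "T.conj y h \<in> {h, inv\<^bsub>?G\<^esub> h}"
    using T.normalizes_large_centralizer[of h y] h y(1) large by (simp add: T.cent_def)
  then show False using y h by (simp add: T.conj_def invK)
qed

end

section \<open>Two icosahedral subgroups\<close>

text \<open>\<open>x w = w' x\<close> instead of \<open>x w x\<inverse> = w'\<close>: elements of \<open>S\<close> need not be reduced modulo \<open>p\<close>.\<close>

definition stab :: "int \<Rightarrow> (int \<times> int \<times> int \<times> int) set \<Rightarrow> (int \<times> int \<times> int \<times> int) set" where
  "stab p S = {x \<in> carrier (SL2 p).
     (\<forall>w\<in>S. \<exists>w'\<in>S. x \<otimes>\<^bsub>SL2 p\<^esub> w = w' \<otimes>\<^bsub>SL2 p\<^esub> x) \<and>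
     (\<forall>w\<in>S. \<exists>w'\<in>S. x \<otimes>\<^bsub>SL2 p\<^esub> w' = w \<otimes>\<^bsub>SL2 p\<^esub> x)}"

context odd_prime
begin

lemma inv_conj:
  assumes "x \<in> carrier (SL2 p)" "x \<star> w = w' \<star> x"
  shows "inv\<^bsub>SL2 p\<^esub> x \<star> w' = w \<star> inv\<^bsub>SL2 p\<^esub> x"
proof -
  let ?y = "inv\<^bsub>SL2 p\<^esub> x"
  have "?y \<star> (x \<star> w) \<star> ?y = ?y \<star> (w' \<star> x) \<star> ?y" using assms(2) by simp
  moreover have "?y \<star> (x \<star> w) \<star> ?y = w \<star> ?y"
    using assms(1) by (simp add: SL2_assoc[symmetric] one_mult mult_red)
  moreover have "?y \<star> (w' \<star> x) \<star> ?y = ?y \<star> w'"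
    using assms(1) by (simp add: SL2_assoc one_mult mult_red)
  ultimately show ?thesis by simp
qed

text \<open>Inversion exchanges the two clauses of \<open>stab\<close>.\<close>

lemma subgroup_stab: "subgroup (stab p S) (SL2 p)"
proof (rule subgroupI)
  show "stab p S \<subseteq> carrier (SL2 p)" by (auto simp: stab_def)
  have "\<one>\<^bsub>SL2 p\<^esub> \<in> stab p S" by (auto simp: stab_def one_mult)
  then show "stab p S \<noteq> {}" by blast
  show "inv\<^bsub>SL2 p\<^esub> x \<in> stab p S" if x: "x \<in> stab p S" for x
  proof -
    have xc: "x \<in> carrier (SL2 p)" using x unfolding stab_def by blast
    have "\<exists>w'\<in>S. inv\<^bsub>SL2 p\<^esub> x \<star> w = w' \<star> inv\<^bsub>SL2 p\<^esub> x" "\<exists>w'\<in>S. inv\<^bsub>SL2 p\<^esub> x \<star> w' = w \<star> inv\<^bsub>SL2 p\<^esub> x"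
      if "w \<in> S" for w
      using x inv_conj[OF xc] that unfolding stab_def by blast+
    then show ?thesis using inv_closed[OF xc] unfolding stab_def by blast
  qed
  show "x \<star> y \<in> stab p S" if x: "x \<in> stab p S" and y: "y \<in> stab p S" for x y
  proof -
    have comp: "x \<star> y \<star> u = w \<star> (x \<star> y)" if "y \<star> u = v \<star> y" "x \<star> v = w \<star> x" for u v w
      using that by (metis SL2_assoc)
    have "\<exists>w\<in>S. x \<star> y \<star> u = w \<star> (x \<star> y)" "\<exists>w\<in>S. x \<star> y \<star> w = u \<star> (x \<star> y)" if "u \<in> S" for u
      using x y that comp unfolding stab_def by blast+
    then show ?thesis using x y unfolding stab_def by blast
  qed
qed

text \<open>The conjugate of \<open>H\<close> by \<open>r\<close>, in a form that makes sense for
  \<open>r\<close> outside SL(2,p); the \<open>r\<close> used below has norm 3.\<close>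

lemma subgroup_intertwined:
  assumes H: "subgroup H (SL2 p)"
  shows "subgroup {x \<in> carrier (SL2 p). \<exists>y\<in>H. x \<star> r = r \<star> y} (SL2 p)" (is "subgroup ?H _")
proof (rule subgroupI)
  show "?H \<subseteq> carrier (SL2 p)" by auto
  have "\<one>\<^bsub>SL2 p\<^esub> \<in> ?H" using subgroup.one_closed[OF H] by (auto simp: one_mult intro!: bexI[of _ "\<one>\<^bsub>SL2 p\<^esub>"])
  then show "?H \<noteq> {}" by blast
  fix x x' assume "x \<in> ?H"
  then obtain y where x: "x \<in> carrier (SL2 p)" and y: "y \<in> H" and xy: "x \<star> r = r \<star> y" by blast
  have yc: "y \<in> carrier (SL2 p)" using subgroup.mem_carrier[OF H y] .
  have "inv\<^bsub>SL2 p\<^esub> x \<star> (x \<star> r) \<star> inv\<^bsub>SL2 p\<^esub> y = inv\<^bsub>SL2 p\<^esub> x \<star> (r \<star> y) \<star> inv\<^bsub>SL2 p\<^esub> y" using xy by simp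
  moreover have "inv\<^bsub>SL2 p\<^esub> x \<star> (x \<star> r) \<star> inv\<^bsub>SL2 p\<^esub> y = r \<star> inv\<^bsub>SL2 p\<^esub> y"
    using x yc by (simp add: SL2_assoc[symmetric] one_mult mult_red)
  moreover have "inv\<^bsub>SL2 p\<^esub> x \<star> (r \<star> y) \<star> inv\<^bsub>SL2 p\<^esub> y = inv\<^bsub>SL2 p\<^esub> x \<star> r"
    using x yc by (simp add: SL2_assoc one_mult mult_red)
  ultimately have "inv\<^bsub>SL2 p\<^esub> x \<star> r = r \<star> inv\<^bsub>SL2 p\<^esub> y" by simp
  then show "inv\<^bsub>SL2 p\<^esub> x \<in> ?H" using x subgroup.m_inv_closed[OF H y] by auto
  assume "x' \<in> ?H"
  then obtain y' where x': "x' \<in> carrier (SL2 p)" and y': "y' \<in> H" "x' \<star> r = r \<star> y'" by blast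
  have "x \<star> x' \<star> r = r \<star> (y \<star> y')" using xy y' by (metis SL2_assoc)
  then show "x \<star> x' \<in> ?H" using x x' subgroup.m_closed[OF H y y'(1)] by auto
qed

end

text \<open>\<open>\<iota>\<close> is a square root of -1, \<open>\<phi>\<close> the golden ratio,
  and \<open>h\<close>, \<open>t\<close> are 1/2 and 1/3. In \<open>ndvd\<close>, 5 is the square of
  \<open>2*\<phi> - 1\<close>, 19 comes from the norm of \<open>4*\<phi> - 1\<close>, and 11 and 59
  come from powers of the product of \<open>g1\<close> and \<open>g3\<close>.\<close>

locale icosahedral = odd_prime +
  fixes \<iota> \<phi> h t :: int
  assumes iota: "p dvd \<iota>*\<iota> + 1" and phi: "p dvd \<phi>*\<phi> - \<phi> - 1"
    and half: "p dvd 2*h - 1" and third: "p dvd 3*t - 1"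
    and ndvd: "\<not> p dvd 2" "\<not> p dvd 3" "\<not> p dvd 5" "\<not> p dvd 11" "\<not> p dvd 19" "\<not> p dvd 59"
begin

text \<open>The quaternion \<open>a + b i + c j + d k\<close>, with \<open>i\<close> diagonal.\<close>

definition quat where
  "quat a b c d = red p (a + b*\<iota>, c + d*\<iota>, - c + d*\<iota>, a - b*\<iota>)"

lemma quat_mult: "quat a b c d \<star> quat a' b' c' d' =
  quat (a*a' - b*b' - c * c' - d*d') (a*b' + b*a' + c * d' - d * c')
     (a * c' - b*d' + c * a' + d*b') (a*d' + b * c' - c * b' + d*a')"
  unfolding quat_def mult_red unfolding SL2_mult red_simp prod.inject mod_eq_iff
proof (intro conjI)
  \<comment> \<open>The factor \<open>k\<close> is in each case the coefficient of
    \<open>\<iota>*\<iota>\<close> in the expanded product.\<close>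
  have D: "p dvd x - y" if "x - y = k * (\<iota>*\<iota> + 1)" for x y k
    using that iota by simp
  show "p dvd (a + b*\<iota>)*(a' + b'*\<iota>) + (c + d*\<iota>)*(- c' + d'*\<iota>)
      - (a*a' - b*b' - c * c' - d*d' + (a*b' + b*a' + c * d' - d * c')*\<iota>)"
    by (rule D[of _ _ "b*b' + d*d'"]) (simp add: algebra_simps)
  show "p dvd (a + b*\<iota>)*(c' + d'*\<iota>) + (c + d*\<iota>)*(a' - b'*\<iota>)
      - (a * c' - b*d' + c * a' + d*b' + (a*d' + b * c' - c * b' + d*a')*\<iota>)"
    by (rule D[of _ _ "b*d' - d*b'"]) (simp add: algebra_simps)
  show "p dvd (- c + d*\<iota>)*(a' + b'*\<iota>) + (a - b*\<iota>)*(- c' + d'*\<iota>)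
      - (- (a * c' - b*d' + c * a' + d*b') + (a*d' + b * c' - c * b' + d*a')*\<iota>)"
    by (rule D[of _ _ "d*b' - b*d'"]) (simp add: algebra_simps)
  show "p dvd (- c + d*\<iota>)*(c' + d'*\<iota>) + (a - b*\<iota>)*(a' - b'*\<iota>)
      - (a*a' - b*b' - c * c' - d*d' - (a*b' + b*a' + c * d' - d * c')*\<iota>)"
    by (rule D[of _ _ "b*b' + d*d'"]) (simp add: algebra_simps)
qed

lemma quat_eq_iff: "quat a b c d = quat a' b' c' d' \<longleftrightarrow>
  p dvd a - a' \<and> p dvd b - b' \<and> p dvd c - c' \<and> p dvd d - d'" (is "?L \<longleftrightarrow> ?R")
proof
  assume ?R
  then show ?L unfolding quat_def by (intro red_eqI) (Groebner_Basis.algebra+)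
next
  assume ?L
  then have "p dvd (a + b*\<iota>) - (a' + b'*\<iota>)" "p dvd (c + d*\<iota>) - (c' + d'*\<iota>)"
    "p dvd (- c + d*\<iota>) - (- c' + d'*\<iota>)" "p dvd (a - b*\<iota>) - (a' - b'*\<iota>)"
    unfolding quat_def red_simp prod.inject mod_eq_iff by blast+
  then have "p dvd 2*(a - a')" "p dvd 2*(b - b')" "p dvd 2*(c - c')" "p dvd 2*(d - d')"
    using iota by Groebner_Basis.algebra+
  then show ?R using ndvd(1) by (simp only: p_dvd_mult_iff simp_thms)
qed

lemma quat_carrier: "p dvd a*a + b*b + c * c + d*d - 1 \<Longrightarrow> quat a b c d \<in> carrier (SL2 p)"
  unfolding quat_def by (rule red_in_carrier) (use iota in Groebner_Basis.algebra)

lemma quat_one: "quat 1 0 0 0 = \<one>\<^bsub>SL2 p\<^esub>"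
  using p_gt_2 by (simp add: quat_def SL2_one)

lemma quat_minus_one: "quat (-1) 0 0 0 = (p-1,0,0,p-1)"
proof -
  have "(-1) mod p = (p-1) mod p" by (simp add: mod_eq_iff)
  also have "\<dots> = p - 1" using p_gt_2 by (intro mod_pos_pos_trivial) auto
  finally show ?thesis by (simp add: quat_def)
qed

lemma quat_centre: "quat a b c d \<in> centre_SL2 p \<Longrightarrow> p dvd b \<and> p dvd c \<and> p dvd d"
  using quat_eq_iff[of a b c d 1 0 0 0] quat_eq_iff[of a b c d "-1" 0 0 0]
  by (auto simp: centre_SL2_def quat_minus_one quat_one SL2_one)

lemma not_dvd_simps: "\<not> p dvd 1" "\<not> p dvd \<phi>" "\<not> p dvd h" "\<not> p dvd t" "\<not> p dvd \<iota>" "\<not> p dvd 2*\<phi> - 1"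
proof -
  show 1: "\<not> p dvd 1" using p_gt_2 by (auto dest: zdvd_imp_le)
  have "p dvd \<phi> \<Longrightarrow> p dvd 1" "p dvd h \<Longrightarrow> p dvd 1" "p dvd t \<Longrightarrow> p dvd 1" "p dvd \<iota> \<Longrightarrow> p dvd 1"
    using iota phi half third by Groebner_Basis.algebra+
  then show "\<not> p dvd \<phi>" "\<not> p dvd h" "\<not> p dvd t" "\<not> p dvd \<iota>" using 1 by blast+
  have "p dvd 2*\<phi> - 1 \<Longrightarrow> p dvd 5" using phi by Groebner_Basis.algebra
  then show "\<not> p dvd 2*\<phi> - 1" using ndvd by blast
qed

text \<open>\<open>r\<close> spans the axis of the rotation \<open>g2\<close> of order 3, and \<open>g1 = r g3 r\<inverse>\<close>.\<close>

definition "g1 = quat 0 (- t*(2*\<phi> - 1)) (2*t) 0"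
definition "g2 = quat h (h*(\<phi> - 1)) (h*\<phi>) 0"
definition "g3 = quat 0 1 0 0"
definition "z = quat 0 0 0 1"
definition "r = quat 0 (\<phi> - 1) \<phi> 0"

lemma gens_carrier: "g1 \<in> carrier (SL2 p)" "g2 \<in> carrier (SL2 p)" "g3 \<in> carrier (SL2 p)" "z \<in> carrier (SL2 p)"
  unfolding g1_def g2_def g3_def z_def
  by (rule quat_carrier; (simp add: algebra_simps; fail | use phi half third in Groebner_Basis.algebra))+

text \<open>Cyclic permutations of \<open>(\<phi>, 1, 0)\<close> and \<open>(\<phi>, -1, 0)\<close>,
  up to sign. They stay unnormalised, as their norm \<open>\<phi> + 2\<close> need not be a square
  modulo \<open>p\<close>.\<close>

definition "A1 s = quat 0 (s*\<phi>) s 0"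
definition "A2 s = quat 0 (s*\<phi>) (-s) 0"
definition "A3 s = quat 0 0 (s*\<phi>) s"
definition "A4 s = quat 0 0 (s*\<phi>) (-s)"
definition "A5 s = quat 0 s 0 (s*\<phi>)"
definition "A6 s = quat 0 (-s) 0 (s*\<phi>)"
lemmas A_defs = A1_def A2_def A3_def A4_def A5_def A6_def

text \<open>\<open>A1 s\<close> to \<open>A6 s\<close> with \<open>s = 1, -1\<close> are the vertices of an icosahedron, which \<open>g2\<close>, \<open>g3\<close> and \<open>z\<close> permute.\<close>

definition "vertices = (\<Union>s\<in>{1,-1}. {A1 s, A2 s, A3 s, A4 s, A5 s, A6 s})"

lemma g3_perm: "g3 \<star> A1 s = A2 s \<star> g3" "g3 \<star> A2 s = A1 s \<star> g3" "g3 \<star> A3 s = A3 (-s) \<star> g3"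
  "g3 \<star> A4 s = A4 (-s) \<star> g3" "g3 \<star> A5 s = A6 (-s) \<star> g3" "g3 \<star> A6 s = A5 (-s) \<star> g3"
  by (simp_all add: g3_def A_defs quat_mult)

lemma z_perm: "z \<star> A1 s = A1 (-s) \<star> z" "z \<star> A2 s = A2 (-s) \<star> z" "z \<star> A3 s = A4 (-s) \<star> z"
  "z \<star> A4 s = A3 (-s) \<star> z" "z \<star> A5 s = A6 s \<star> z" "z \<star> A6 s = A5 s \<star> z"
  by (simp_all add: z_def A_defs quat_mult)

lemma g2_perm: "g2 \<star> A1 s = A4 s \<star> g2" "g2 \<star> A2 s = A5 (-s) \<star> g2" "g2 \<star> A3 s = A1 s \<star> g2"
  "g2 \<star> A4 s = A3 s \<star> g2" "g2 \<star> A5 s = A6 (-s) \<star> g2" "g2 \<star> A6 s = A2 s \<star> g2"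
  unfolding g2_def A_defs quat_mult quat_eq_iff
  by (intro conjI; (simp add: algebra_simps; fail | use phi in Groebner_Basis.algebra))+

lemma vertices_cases:
  assumes "w \<in> vertices"
  obtains s where "s = 1 \<or> s = -1" "w = A1 s \<or> w = A2 s \<or> w = A3 s \<or> w = A4 s \<or> w = A5 s \<or> w = A6 s"
  using assms unfolding vertices_def by blast

lemma vertices_mem:
  assumes "s = 1 \<or> s = -1"
  shows "A1 s \<in> vertices" "A2 s \<in> vertices" "A3 s \<in> vertices" "A4 s \<in> vertices" "A5 s \<in> vertices" "A6 s \<in> vertices"
    "A1 (-s) \<in> vertices" "A2 (-s) \<in> vertices" "A3 (-s) \<in> vertices" "A4 (-s) \<in> vertices" "A5 (-s) \<in> vertices" "A6 (-s) \<in> vertices"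
  using assms unfolding vertices_def by auto

lemma gens_stab_vertices: "g2 \<in> stab p vertices" "g3 \<in> stab p vertices" "z \<in> stab p vertices"
proof -
  have A: "(\<exists>w'\<in>vertices. x \<star> w = w' \<star> x) \<and> (\<exists>w'\<in>vertices. x \<star> w' = w \<star> x)"
    if w: "w \<in> vertices" and x: "x = g2 \<or> x = g3 \<or> x = z" for w x
  proof -
    obtain s where s: "s = 1 \<or> s = -1"
      "w = A1 s \<or> w = A2 s \<or> w = A3 s \<or> w = A4 s \<or> w = A5 s \<or> w = A6 s"
      using vertices_cases[OF w] .
    note v = vertices_mem[OF s(1)]
    from x show ?thesis
    proof (elim disjE)
      assume "x = g2"
      then show ?thesis using s(2) v g2_perm[of s] g2_perm[of "-s", unfolded minus_minus] by blast
    next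
      assume "x = g3"
      then show ?thesis using s(2) v g3_perm[of s] g3_perm[of "-s", unfolded minus_minus] by blast
    next
      assume "x = z"
      then show ?thesis using s(2) v z_perm[of s] z_perm[of "-s", unfolded minus_minus] by blast
    qed
  qed
  show "g2 \<in> stab p vertices" "g3 \<in> stab p vertices" "z \<in> stab p vertices"
    using gens_carrier A unfolding stab_def by blast+
qed

text \<open>The half-turn \<open>g1\<close> preserves the plane of i and j, so \<open>A1 1\<close>
  could only go to some \<open>A1 s\<close> or \<open>A2 s\<close>. These four cases would make
  \<open>p\<close> divide 19 or a product of 2, \<open>t\<close>, \<open>\<phi>\<close> and
  \<open>2*\<phi> - 1\<close>.\<close>

lemma g1_not_stab_vertices: "g1 \<notin> stab p vertices"
proof
  assume "g1 \<in> stab p vertices"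
  then obtain w where w: "w \<in> vertices" "g1 \<star> A1 1 = w \<star> g1"
    using vertices_mem(1)[of 1] by (auto simp: stab_def)
  let ?u = "- t*(2*\<phi> - 1)" and ?v = "2*t"
  \<comment> \<open>The i, real and k coordinates of the intertwining equation.\<close>
  have coeffs: "p dvd ?v*d \<and> p dvd (?u*\<phi> + ?v) - (b*?u + c*?v) \<and> p dvd (?u - ?v*\<phi>) - (b*?v - c*?u)"
    if "w = quat 0 b c d" for b c d
  proof -
    have "quat 0 ?u ?v 0 \<star> quat 0 \<phi> 1 0 = quat 0 b c d \<star> quat 0 ?u ?v 0"
      using w(2) unfolding that g1_def A1_def by simp
    then show ?thesis unfolding quat_mult quat_eq_iff by (elim conjE; intro conjI; Groebner_Basis.algebra)
  qed
  obtain s where s: "s = 1 \<or> s = -1"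
    "w = A1 s \<or> w = A2 s \<or> w = A3 s \<or> w = A4 s \<or> w = A5 s \<or> w = A6 s"
    using vertices_cases[OF w(1)] .
  have "\<not> p dvd s" using s(1) not_dvd_simps(1) by auto
  then have off: False if "p dvd ?v*d" "d = s \<or> d = - s \<or> d = s*\<phi>" for d
    using that not_dvd_simps ndvd(1) by (auto simp: p_dvd_mult_iff)
  consider "w = A1 s" | "w = A2 s" | "w = A3 s \<or> w = A4 s \<or> w = A5 s \<or> w = A6 s" using s(2) by blast
  then show False
  proof cases
    case 1
    note C = coeffs[OF 1[unfolded A1_def], THEN conjunct2]
    from s(1) show False
    proof
      assume "s = 1"
      then have "p dvd 2 * t * (4*\<phi> - 1)" using C by Groebner_Basis.algebra
      then have "p dvd 4*\<phi> - 1" using not_dvd_simps ndvd(1) by (simp only: p_dvd_mult_iff simp_thms)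
      then have "p dvd 19" using phi by Groebner_Basis.algebra
      then show False using ndvd by blast
    next
      assume "s = -1"
      then have "p dvd 2 * t * \<phi>" using C phi by Groebner_Basis.algebra
      then show False using not_dvd_simps ndvd(1) by (simp only: p_dvd_mult_iff simp_thms)
    qed
  next
    case 2
    note C = coeffs[OF 2[unfolded A2_def], THEN conjunct2, THEN conjunct1]
    from s(1) show False
    proof
      assume "s = 1"
      then have "p dvd 2 * 2 * t" using C by Groebner_Basis.algebra
      then show False using not_dvd_simps ndvd(1) by (simp only: p_dvd_mult_iff simp_thms)
    next
      assume "s = -1"
      then have "p dvd 2 * t * (2*\<phi> - 1) * \<phi>" using C by (simp add: algebra_simps dvd_diff_commute)
      then show False using not_dvd_simps ndvd(1) by (simp only: p_dvd_mult_iff simp_thms)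
    qed
  next
    case 3
    then consider "w = A3 s" | "w = A4 s" | "w = A5 s" | "w = A6 s" by blast
    then show False
    proof cases
      case 1 show False using coeffs[OF 1[unfolded A3_def]] off[of s] by blast
    next
      case 2 show False using coeffs[OF 2[unfolded A4_def]] off[of "-s"] by blast
    next
      case 3 show False using coeffs[OF 3[unfolded A5_def]] off[of "s*\<phi>"] by blast
    next
      case 4 show False using coeffs[OF 4[unfolded A6_def]] off[of "s*\<phi>"] by blast
    qed
  qed
qed

lemma inv_z: "inv\<^bsub>SL2 p\<^esub> z = quat 0 0 0 (-1)"
proof -
  have "quat 0 0 0 (-1) \<star> z = \<one>\<^bsub>SL2 p\<^esub>" by (simp add: z_def quat_mult quat_one)
  moreover have "quat 0 0 0 (-1) \<in> carrier (SL2 p)" by (rule quat_carrier) simp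
  ultimately show ?thesis using gens_carrier by (intro inv_equality)
qed

text \<open>Conjugation by the pure quaternion \<open>r\<close> is a half-turn: it exchanges
  \<open>g1\<close> and \<open>g3\<close>, fixes \<open>g2\<close>, whose axis is \<open>r\<close>,
  and inverts \<open>z\<close>, whose axis is orthogonal to \<open>r\<close>.\<close>

lemma g1_r: "g1 \<star> r = r \<star> g3" "g3 \<star> r = r \<star> g1" "g2 \<star> r = r \<star> g2"
  "z \<star> r = r \<star> inv\<^bsub>SL2 p\<^esub> z"
proof -
  show "g1 \<star> r = r \<star> g3" "g3 \<star> r = r \<star> g1" "g2 \<star> r = r \<star> g2"
    unfolding g1_def g2_def g3_def r_def quat_mult quat_eq_iff
    by (intro conjI; (simp add: algebra_simps; fail | use phi third in Groebner_Basis.algebra))+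
  show "z \<star> r = r \<star> inv\<^bsub>SL2 p\<^esub> z" unfolding inv_z by (simp add: z_def r_def quat_mult)
qed

lemma r_cancel_left:
  assumes "r \<star> x = r \<star> y" "x \<in> carrier (SL2 p)" "y \<in> carrier (SL2 p)"
  shows "x = y"
proof -
  \<comment> \<open>As \<open>r\<close> squares to -3, its inverse is \<open>-t\<close> times
    \<open>r\<close>.\<close>
  have "quat (-t) 0 0 0 \<star> r \<star> r = \<one>\<^bsub>SL2 p\<^esub>"
    unfolding r_def quat_mult quat_one[symmetric] quat_eq_iff
    by (intro conjI; (simp add: algebra_simps; fail | use phi third in Groebner_Basis.algebra))
  then have "\<one>\<^bsub>SL2 p\<^esub> \<star> x = \<one>\<^bsub>SL2 p\<^esub> \<star> y" using assms(1) by (metis SL2_assoc)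
  then show ?thesis using assms(2,3) by simp
qed

section \<open>The three proper subgroups\<close>

definition "H1 = stab p vertices"
definition "H2 = stab p {z, inv\<^bsub>SL2 p\<^esub> z}"
definition "H3 = {x \<in> carrier (SL2 p). \<exists>y\<in>H1. x \<star> r = r \<star> y}"

lemma subgroup_H: "subgroup H1 (SL2 p)" "subgroup H2 (SL2 p)" "subgroup H3 (SL2 p)"
  unfolding H1_def H2_def H3_def by (intro subgroup_stab subgroup_intertwined)+

lemma H1: "g2 \<in> H1" "g3 \<in> H1" "z \<in> H1" "g1 \<notin> H1"
  unfolding H1_def using gens_stab_vertices g1_not_stab_vertices by blast+

text \<open>Intertwining by \<open>r\<close> turns membership in \<open>H3\<close> into membership
  in \<open>H1\<close>; in particular \<open>g3\<close> corresponds to \<open>g1\<close>.\<close>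

lemma H3: "g1 \<in> H3" "g2 \<in> H3" "z \<in> H3" "g3 \<notin> H3"
proof -
  show "g1 \<in> H3" "g2 \<in> H3" "z \<in> H3"
    unfolding H3_def using g1_r gens_carrier H1 subgroup.m_inv_closed[OF subgroup_H(1)] by blast+
  show "g3 \<notin> H3"
  proof
    assume "g3 \<in> H3"
    then obtain y where y: "y \<in> H1" "r \<star> g1 = r \<star> y" using g1_r by (auto simp: H3_def)
    then have "g1 = y" using r_cancel_left gens_carrier subgroup.mem_carrier[OF subgroup_H(1)] by blast
    then show False using y H1 by blast
  qed
qed

lemma H2: "g1 \<in> H2" "g3 \<in> H2" "z \<in> H2" "g2 \<notin> H2"
proof -
  show "g1 \<in> H2" "g3 \<in> H2" "z \<in> H2"
    using gens_carrier unfolding H2_def stab_def inv_z unfolding z_def g1_def g3_def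
    by (simp_all add: quat_mult)
  show "g2 \<notin> H2"
  proof
    assume "g2 \<in> H2"
    then have "g2 \<star> z = z \<star> g2 \<or> g2 \<star> z = inv\<^bsub>SL2 p\<^esub> z \<star> g2" by (auto simp: H2_def stab_def)
    then have "p dvd 2*h*\<phi> \<or> p dvd 2*h"
      unfolding inv_z unfolding z_def g2_def quat_mult quat_eq_iff by (elim disjE conjE) (simp_all add: algebra_simps)
    then show False using not_dvd_simps ndvd(1) by (simp add: p_dvd_mult_iff)
  qed
qed

lemma centre_subset_H: "centre_SL2 p \<subseteq> H1" "centre_SL2 p \<subseteq> H2" "centre_SL2 p \<subseteq> H3"
proof -
  have C: "c \<in> carrier (SL2 p)" if "c \<in> centre_SL2 p" for c
    using subgroup.mem_carrier[OF subgroup_centre that] .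
  have S: "centre_SL2 p \<subseteq> stab p S" for S using C centre_commutes unfolding stab_def by blast
  show "centre_SL2 p \<subseteq> H1" "centre_SL2 p \<subseteq> H2" unfolding H1_def H2_def by (rule S)+
  then show "centre_SL2 p \<subseteq> H3" unfolding H3_def using C centre_commutes by blast
qed

text \<open>The criterion \<open>subgroup_SL2_eq\<close> is applied to \<open>?h\<close>, a rotation
  about the k-axis, and to \<open>g2\<close>, which tilts this axis.\<close>

lemma generate_gens: "generate (SL2 p) {g1, g2, g3} = carrier (SL2 p)"
proof -
  let ?K = "generate (SL2 p) {g1, g2, g3}"
  let ?x = "t*(2*\<phi> - 1)" and ?y = "- 2*t"
  let ?h = "g1 \<star> g3"
  have K: "subgroup ?K (SL2 p)" using gens_carrier by (intro generate_is_subgroup) auto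
  have gK: "g1 \<in> ?K" "g2 \<in> ?K" "g3 \<in> ?K" by (auto intro: generate.incl)
  have "g3 \<star> g3 = (p-1,0,0,p-1)" by (simp add: g3_def quat_mult flip: quat_minus_one)
  then have Z: "centre_SL2 p \<subseteq> ?K"
    using subgroup.m_closed[OF K gK(3,3)] subgroup.one_closed[OF K] by (simp add: centre_SL2_def SL2_one)
  have h: "?h = quat ?x 0 0 ?y" by (simp add: g1_def g3_def quat_mult algebra_simps)
  have hK: "?h \<in> ?K" using subgroup.m_closed[OF K gK(1,3)] .
  have hc: "?h \<in> carrier (SL2 p)" using gens_carrier by simp
  have y: "\<not> p dvd ?y" using not_dvd_simps ndvd(1) by (simp add: p_dvd_mult_iff)
  have x: "\<not> p dvd ?x" using not_dvd_simps by (simp add: p_dvd_mult_iff)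
  have sq: "p dvd 9*(?x*?x) - 5" "p dvd 9*(?y*?y) - 4" using phi third by Groebner_Basis.algebra+
  define x y where "x = ?x" and "y = ?y"
  \<comment> \<open>As \<open>9 x\<^sup>2 = 5\<close> and \<open>9 y\<^sup>2 = 4\<close>, the \<open>k\<close>-coefficients of the powers up to 5 of \<open>x + y k\<close> vanish only
    modulo 2, 3, 5, 11 or 59.\<close>
  have pow: "?h [^]\<^bsub>SL2 p\<^esub> (n::nat) \<notin> centre_SL2 p" if n: "0 < n" "n < 6" for n
  proof
    assume c: "?h [^]\<^bsub>SL2 p\<^esub> n \<in> centre_SL2 p"
    have h1: "?h [^]\<^bsub>SL2 p\<^esub> (1::nat) = quat x 0 0 y" using hc h by (simp add: x_def y_def)
    have step: "?h [^]\<^bsub>SL2 p\<^esub> Suc m = quat (a*x - b*y) 0 0 (a*y + b*x)"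
      if "?h [^]\<^bsub>SL2 p\<^esub> m = quat a 0 0 b" for m a b
      using that h by (simp add: quat_mult x_def y_def)
    note h2 = step[OF h1] note h3 = step[OF h2] note h4 = step[OF h3] note h5 = step[OF h4]
    note sq' = sq[folded x_def y_def]
    \<comment> \<open>\<open>v\<close> and \<open>w\<close> stand for \<open>9 x^2 = 5\<close> and
      \<open>9 y^2 = 4\<close>, whence \<open>v - w = 1\<close> and
      \<open>5 v^2 - 10 v w + w^2 = 125 - 200 + 16 = -59\<close>.\<close>
    have fourth: "p dvd u" if "p dvd u * (v - w)" "p dvd v - 5" "p dvd w - 4" for u v w :: int
      using that by Groebner_Basis.algebra
    have fifth: "p dvd 59*u" if "p dvd u * (5 * v * v - 10 * v * w + w * w)" "p dvd v - 5" "p dvd w - 4" for u v w :: int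
      using that by Groebner_Basis.algebra
    have "n = 1 \<or> n = Suc 1 \<or> n = Suc (Suc 1) \<or> n = Suc (Suc (Suc 1)) \<or> n = Suc (Suc (Suc (Suc 1)))"
      using n by auto
    then have "p dvd y \<or> p dvd 2*x*y \<or> p dvd 11*y \<or> p dvd 4*x*y \<or> p dvd 59*y"
    proof (elim disjE)
      assume "n = 1" then show ?thesis using c h1 quat_centre by metis
    next
      assume "n = Suc 1"
      then have "p dvd x*y + y*x" using c h2 quat_centre by metis
      then have "p dvd 2*x*y" by Groebner_Basis.algebra
      then show ?thesis by blast
    next
      assume "n = Suc (Suc 1)"
      note quat_centre[OF c[unfolded this h3], THEN conjunct2, THEN conjunct2]
      then have "p dvd 11*y" using sq' by Groebner_Basis.algebra
      then show ?thesis by blast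
    next
      assume "n = Suc (Suc (Suc 1))"
      note quat_centre[OF c[unfolded this h4], THEN conjunct2, THEN conjunct2]
      from dvd_mult[OF this, of 9] have "p dvd 4*x*y*(9*(x*x) - 9*(y*y))"
        by (simp add: algebra_simps)
      then have "p dvd 4*x*y" by (rule fourth[OF _ sq'])
      then show ?thesis by blast
    next
      assume "n = Suc (Suc (Suc (Suc 1)))"
      note quat_centre[OF c[unfolded this h5], THEN conjunct2, THEN conjunct2]
      from dvd_mult[OF this, of 81]
      have "p dvd y*(5*(9*(x*x))*(9*(x*x)) - 10*(9*(x*x))*(9*(y*y)) + (9*(y*y))*(9*(y*y)))"
        by (simp add: algebra_simps)
      then have "p dvd 59*y" by (rule fifth[OF _ sq'])
      then show ?thesis by blast
    qed
    moreover have "p dvd 4*x*y \<Longrightarrow> p dvd 2*(2*x*y)" by (simp add: mult.assoc)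
    ultimately show False using x y ndvd unfolding x_def[symmetric] y_def[symmetric] p_dvd_mult_iff by blast
  qed
  have large: "12 \<le> card {y \<in> ?K. y \<star> ?h = ?h \<star> y}"
    using card_centralizer_ge[OF K Z hK, of 6] pow by simp
  have hZ: "?h \<notin> centre_SL2 p" using pow[of 1] hc by simp
  have "inv\<^bsub>SL2 p\<^esub> ?h = quat ?x 0 0 (-?y)"
  proof (rule inv_equality)
    show "quat ?x 0 0 (-?y) \<star> ?h = \<one>\<^bsub>SL2 p\<^esub>"
      unfolding h quat_mult quat_one[symmetric] quat_eq_iff by (intro conjI; (simp add: algebra_simps; fail | use phi third in Groebner_Basis.algebra))
    show "quat ?x 0 0 (-?y) \<in> carrier (SL2 p)"
      by (rule quat_carrier) (use phi third in Groebner_Basis.algebra)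
  qed (rule hc)
  note invh = this
  have flip: "g2 \<star> ?h \<star> inv\<^bsub>SL2 p\<^esub> g2 \<notin> {?h, inv\<^bsub>SL2 p\<^esub> ?h}"
  proof
    assume "g2 \<star> ?h \<star> inv\<^bsub>SL2 p\<^esub> g2 \<in> {?h, inv\<^bsub>SL2 p\<^esub> ?h}"
    then have "g2 \<star> ?h = ?h \<star> g2 \<or> g2 \<star> ?h = inv\<^bsub>SL2 p\<^esub> ?h \<star> g2"
      using gens_carrier hc by (metis insertE inv_closed inv_solve_right m_closed singletonD)
    then have "p dvd 2*(h*(\<phi>*?y)) \<or> p dvd 2*(h*?y)"
    proof
      assume "g2 \<star> ?h = ?h \<star> g2"
      then have "p dvd 2*(h*(\<phi>*?y))" unfolding h g2_def quat_mult quat_eq_iff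
        by (elim conjE) Groebner_Basis.algebra
      then show ?thesis ..
    next
      assume "g2 \<star> ?h = inv\<^bsub>SL2 p\<^esub> ?h \<star> g2"
      then have "p dvd 2*(h*?y)" unfolding invh unfolding h g2_def quat_mult quat_eq_iff
        by (elim conjE) Groebner_Basis.algebra
      then show ?thesis ..
    qed
    then show False using not_dvd_simps ndvd(1) y unfolding p_dvd_mult_iff by blast
  qed
  have g3e: "g3 = (\<iota> mod p, 0, 0, (-\<iota>) mod p)" by (simp add: g3_def quat_def)
  have g2e: "g2 = ((h + h*(\<phi> - 1)*\<iota>) mod p, (h*\<phi>) mod p, (-(h*\<phi>)) mod p, (h - h*(\<phi> - 1)*\<iota>) mod p)"
    by (simp add: g2_def quat_def)
  \<comment> \<open>\<open>g3\<close> is diagonal with eigenvalues \<open>\<iota>\<close> and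
    \<open>-\<iota>\<close>, so it fixes only the two coordinate lines; \<open>g2\<close> moves
    these, its off-diagonal entries being units.\<close>
  have irr: "\<exists>a b c d. (a,b,c,d) \<in> ?K \<and> \<not> p dvd v * (c * v + d*w) - (a*v + b*w) * w"
    if vw: "\<not> (p dvd v \<and> p dvd w)" for v w
  proof -
    have m: "p dvd u mod p - u" for u by (simp add: mod_eq_iff[symmetric])
    consider "\<not> p dvd v" "\<not> p dvd w" | "p dvd w" "\<not> p dvd v" | "p dvd v" "\<not> p dvd w"
      using vw by blast
    then show ?thesis
    proof cases
      case 1
      let ?a = "\<iota> mod p" and ?d = "(-\<iota>) mod p"
      have "\<not> p dvd v * (0 * v + ?d * w) - (?a * v + 0 * w) * w"
      proof
        assume "p dvd v * (0 * v + ?d * w) - (?a * v + 0 * w) * w"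
        then have "p dvd 2 * \<iota> * v * w" using m[of \<iota>] m[of "-\<iota>"] by Groebner_Basis.algebra
        then show False using 1 ndvd(1) not_dvd_simps unfolding p_dvd_mult_iff by blast
      qed
      then show ?thesis using gK(3) unfolding g3e by blast
    next
      case 2
      obtain a b c d where g: "g2 = (a,b,c,d)" and gd: "p dvd c - (-(h*\<phi>))" using g2e m by blast
      have "p dvd h * \<phi> * v * v" if "p dvd v * (c * v + d*w) - (a*v + b*w) * w"
        using that gd 2(1) by Groebner_Basis.algebra
      then have "\<not> p dvd v * (c * v + d*w) - (a*v + b*w) * w"
        using 2(2) not_dvd_simps unfolding p_dvd_mult_iff by blast
      then show ?thesis using gK(2) unfolding g by blast
    next
      case 3
      obtain a b c d where g: "g2 = (a,b,c,d)" and gd: "p dvd b - h*\<phi>" using g2e m by blast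
      have "p dvd h * \<phi> * w * w" if "p dvd v * (c * v + d*w) - (a*v + b*w) * w"
        using that gd 3(1) by Groebner_Basis.algebra
      then have "\<not> p dvd v * (c * v + d*w) - (a*v + b*w) * w"
        using 3(2) not_dvd_simps unfolding p_dvd_mult_iff by blast
      then show ?thesis using gK(2) unfolding g by blast
    qed
  qed
  show ?thesis using subgroup_SL2_eq[OF K Z irr hK hZ large gK(2) flip] .
qed

end

section \<open>Descent to \<open>PSL(2,p)\<close>\<close>

lemma nth_others:
  "{[a, b, c] ! j |j. j < length [a, b, c] \<and> j \<noteq> 0} = {b, c}"
  "{[a, b, c] ! j |j. j < length [a, b, c] \<and> j \<noteq> 1} = {a, c}"
  "{[a, b, c] ! j |j. j < length [a, b, c] \<and> j \<noteq> 2} = {a, b}"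
proof -
  have "{j. j < length [a, b, c] \<and> j \<noteq> 0} = {1, 2}" "{j. j < length [a, b, c] \<and> j \<noteq> 1} = {0, 2}"
    "{j. j < length [a, b, c] \<and> j \<noteq> 2} = {0, 1}"
    by auto
  then show "{[a, b, c] ! j |j. j < length [a, b, c] \<and> j \<noteq> 0} = {b, c}"
    "{[a, b, c] ! j |j. j < length [a, b, c] \<and> j \<noteq> 1} = {a, c}"
    "{[a, b, c] ! j |j. j < length [a, b, c] \<and> j \<noteq> 2} = {a, b}"
    unfolding setcompr_eq_image by (simp_all only:) auto
qed

context odd_prime
begin

abbreviation proj where "proj x \<equiv> centre_SL2 p #>\<^bsub>SL2 p\<^esub> x"

lemma normal_centre: "centre_SL2 p \<lhd> SL2 p"
proof (rule normal_invI[OF subgroup_centre])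
  fix x z assume "z \<in> centre_SL2 p" "x \<in> carrier (SL2 p)"
  moreover from this have "x \<star> z \<star> inv\<^bsub>SL2 p\<^esub> x = z"
    using centre_commutes[of z x] subgroup.mem_carrier[OF subgroup_centre] by (simp add: m_assoc flip: centre_commutes[of z x])
  ultimately show "x \<star> z \<star> inv\<^bsub>SL2 p\<^esub> x \<in> centre_SL2 p" by simp
qed

lemma group_PSL2: "group (PSL2 p)"
  unfolding PSL2_def using normal.factorgroup_is_group[OF normal_centre] .

lemma proj_hom: "group_hom (SL2 p) (PSL2 p) proj"
  using group_PSL2 group_SL2 normal.r_coset_hom_Mod[OF normal_centre]
  by (simp add: group_hom_def group_hom_axioms_def PSL2_def)

lemma carrier_PSL2: "carrier (PSL2 p) = proj ` carrier (SL2 p)"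
  by (auto simp: PSL2_def FactGroup_def RCOSETS_def)

lemma proj_mem:
  assumes H: "subgroup H (SL2 p)" "centre_SL2 p \<subseteq> H" and x: "x \<in> carrier (SL2 p)" "proj x \<in> proj ` H"
  shows "x \<in> H"
proof -
  obtain y where y: "y \<in> H" "proj x = proj y" using x(2) by blast
  have "x \<in> proj y" using rcos_self[OF x(1) subgroup_centre] y(2) by simp
  then obtain z where "z \<in> centre_SL2 p" "x = z \<star> y" unfolding r_coset_def by blast
  then show ?thesis using subgroup.m_closed[OF H(1)] H(2) y(1) by blast
qed

lemma generate_proj_subset:
  assumes H: "subgroup H (SL2 p)" and A: "A \<subseteq> H"
  shows "generate (PSL2 p) (proj ` A) \<subseteq> proj ` H"
proof -
  have "generate (SL2 p) A \<subseteq> H" using generate_subgroup_incl[OF A H] .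
  moreover have "A \<subseteq> carrier (SL2 p)" using A subgroup.subset[OF H] by blast
  ultimately show ?thesis using group_hom.generate_img[OF proj_hom] by blast
qed

text \<open>A subgroup above the centre is the full preimage of its image, so nonmembership survives
  the projection.\<close>

lemma generate_proj_neq:
  assumes H: "subgroup H (SL2 p)" "centre_SL2 p \<subseteq> H" and A: "A \<subseteq> H"
    and x: "x \<in> carrier (SL2 p)" "x \<notin> H"
  shows "proj x \<notin> generate (PSL2 p) (proj ` A)"
  using generate_proj_subset[OF H(1) A] proj_mem[OF H x(1)] x(2) by blast

end

context icosahedral
begin

lemma not_replacement:
  assumes "max_irr_len (PSL2 p) = 3"
  shows "\<not> replacement_property (PSL2 p)"
proof
  assume R: "replacement_property (PSL2 p)"
  let ?s = "[proj g1, proj g2, proj g3]"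
  have in_PSL2: "proj x \<in> carrier (PSL2 p)" if "x \<in> carrier (SL2 p)" for x
    using that by (simp add: carrier_PSL2)
  have gen: "generate (PSL2 p) (proj ` {g1, g2, g3}) = carrier (PSL2 p)"
    using group_hom.generate_img[OF proj_hom, of "{g1, g2, g3}"] gens_carrier
    by (simp add: generate_gens carrier_PSL2)
  \<comment> \<open>Each subgroup serves twice: for irredundancy, and to show that replacing the
    generator outside it by \<open>z\<close> leaves a proper subgroup.\<close>
  note neq = generate_proj_neq[OF subgroup_H(1) centre_subset_H(1) _ gens_carrier(1) H1(4)]
    generate_proj_neq[OF subgroup_H(2) centre_subset_H(2) _ gens_carrier(2) H2(4)]
    generate_proj_neq[OF subgroup_H(3) centre_subset_H(3) _ gens_carrier(3) H3(4)]
  have "irredundant_gen_seq (PSL2 p) ?s"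
    unfolding irredundant_gen_seq_def
  proof (intro conjI allI impI)
    show "set ?s \<subseteq> carrier (PSL2 p)" using gens_carrier in_PSL2 by simp
    show "generate (PSL2 p) (set ?s) = carrier (PSL2 p)" using gen by simp
    fix i assume "i < length ?s"
    then consider "i = 0" | "i = 1" | "i = 2" by fastforce
    then show "?s ! i \<notin> generate (PSL2 p) {?s ! j |j. j < length ?s \<and> j \<noteq> i}"
    proof cases
      case 1
      show ?thesis unfolding 1 nth_others using neq(1)[of "{g2, g3}"] H1 by simp
    next
      case 2
      show ?thesis unfolding 2 nth_others using neq(2)[of "{g1, g3}"] H2 by simp
    next
      case 3
      show ?thesis unfolding 3 nth_others using neq(3)[of "{g1, g2}"] H3 by simp
    qed
  qed
  then have rp: "seq_replacement_property (PSL2 p) ?s"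
    using R assms by (simp add: replacement_property_def)
  have "proj z \<noteq> \<one>\<^bsub>PSL2 p\<^esub>"
  proof
    assume "proj z = \<one>\<^bsub>PSL2 p\<^esub>"
    then have "z \<in> centre_SL2 p"
      using rcos_self[OF gens_carrier(4) subgroup_centre] by (simp add: PSL2_def FactGroup_def)
    then show False unfolding z_def using quat_centre not_dvd_simps(1) by blast
  qed
  then obtain i where i: "i < length ?s" "generate (PSL2 p) (set (?s[i := proj z])) = carrier (PSL2 p)"
    using rp gens_carrier in_PSL2 unfolding seq_replacement_property_def by blast
  then consider "i = 0" | "i = 1" | "i = 2" by fastforce
  then show False
  proof cases
    case 1
    then show False using i(2) neq(1)[of "{z, g2, g3}"] H1 in_PSL2 gens_carrier by simp
  next
    case 2
    then show False using i(2) neq(2)[of "{g1, z, g3}"] H2 in_PSL2 gens_carrier by simp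
  next
    case 3
    then show False using i(2) neq(3)[of "{g1, g2, z}"] H3 in_PSL2 gens_carrier by simp
  qed
qed

end

section \<open>Square roots of -1 and 5 modulo \<open>p\<close>\<close>

lemma sqrt_minus_one_mod:
  fixes p :: int
  assumes "Factorial_Ring.prime p" "p > 2" "p mod 4 = 1"
  shows "\<exists>i. p dvd i * i + 1"
proof -
  have pr: "Factorial_Ring.prime (nat p)" using assms by (simp add: prime_nat_iff_prime)
  obtain k where k: "p = 4 * k + 1" using assms(3) by (metis mult_div_mod_eq)
  \<comment> \<open>The exponent in Euler's criterion is \<open>2 * k\<close>.\<close>
  have "even ((nat p - 1) div 2)" using k assms(2) by (simp add: nat_add_distrib nat_mult_distrib)
  then have "(-1::int) ^ ((nat p - 1) div 2) = 1" by simp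
  then have "[Legendre (-1) p = 1] (mod p)"
    using euler_criterion[OF pr, of "-1"] assms by (simp add: nat_less_iff)
  moreover have "\<not> [0 = 1] (mod p)" "\<not> [-1 = 1] (mod p)"
    using assms(2) by (auto simp: cong_iff_dvd_diff dest: zdvd_imp_le)
  ultimately have "QuadRes p (-1)" by (auto simp: Legendre_def split: if_splits)
  then obtain y where "[y^2 = -1] (mod p)" by (auto simp: QuadRes_def)
  then show ?thesis by (auto simp: cong_iff_dvd_diff power2_eq_square)
qed

text \<open>\<open>p\<close> is a square modulo 5, and since 5 is 1 modulo 4, reciprocity makes 5 a
  square modulo \<open>p\<close>.\<close>

lemma sqrt_5_mod:
  fixes p :: int
  assumes "Factorial_Ring.prime p" "p > 5" "p mod 5 = 1 \<or> p mod 5 = 4"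
  shows "\<exists>s. p dvd s * s - 5"
proof -
  have pr: "Factorial_Ring.prime (nat p)" using assms by (simp add: prime_nat_iff_prime)
  have five: "Factorial_Ring.prime (nat 5)" by simp
  have "QuadRes 5 p"
  proof -
    have "[1^2 = p] (mod 5) \<or> [2^2 = p] (mod 5)" using assms(3) by (auto simp: cong_def)
    then show ?thesis unfolding QuadRes_def by blast
  qed
  moreover have "\<not> [p = 0] (mod 5)" using assms(3) by (auto simp: cong_def)
  ultimately have "Legendre p 5 = 1" by (simp add: Legendre_def)
  moreover have "Legendre p 5 * Legendre 5 p = (-1::int) ^ ((nat p - 1) div 2 * ((nat 5 - 1) div 2))"
    using Quadratic_Reciprocity[of "nat p" "nat 5"] pr five assms(2) by (simp add: nat_less_iff)
  ultimately have "Legendre 5 p = 1" by simp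
  then have "QuadRes p 5" by (auto simp: Legendre_def split: if_splits)
  then obtain y where "[y^2 = 5] (mod p)" by (auto simp: QuadRes_def)
  then show ?thesis by (auto simp: cong_iff_dvd_diff power2_eq_square)
qed

theorem theorem2p4:
  fixes p :: int
  assumes "Factorial_Ring.prime p"
    and "p mod 10 = 1 \<or> p mod 10 = 9"
    and "p mod 4 = 1"
    and "max_irr_len (PSL2 p) = 3"
  shows "\<not> replacement_property (PSL2 p)"
proof -
  have p: "p > 1" using assms(1) prime_gt_1_int by blast
  \<comment> \<open>3, 11, 19 and 59 are 3 modulo 4, while 2 and 5 are neither 1 nor 9 modulo
    10.\<close>
  have ne: "p \<noteq> 2" "p \<noteq> 3" "p \<noteq> 5" "p \<noteq> 11" "p \<noteq> 19" "p \<noteq> 59" using assms(2,3) by auto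
  have p5: "p > 5"
  proof -
    have "p \<noteq> 4" using assms(3) by auto
    then show ?thesis using p ne by linarith
  qed
  have "p mod 5 = 1 \<or> p mod 5 = 4" using assms(2) by presburger
  then obtain s where s: "p dvd s * s - 5" using sqrt_5_mod assms(1) p5 by blast
  obtain i where i: "p dvd i * i + 1" using sqrt_minus_one_mod assms(1,3) p5 by fastforce
  interpret odd_prime p using assms(1) p5 by unfold_locales auto
  have ndvd: "\<not> p dvd q" if "Factorial_Ring.prime q" "p \<noteq> q" for q :: int
    using that assms(1) by (metis primes_dvd_imp_eq)
  have primes: "Factorial_Ring.prime (2::int)" "Factorial_Ring.prime (3::int)" "Factorial_Ring.prime (5::int)"
    "Factorial_Ring.prime (11::int)" "Factorial_Ring.prime (19::int)" "Factorial_Ring.prime (59::int)"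
    by simp_all
  obtain h where h: "p dvd 2 * h - 1" using inverse_mod ndvd primes ne by metis
  obtain t where t: "p dvd 3 * t - 1" using inverse_mod ndvd primes ne by metis
  \<comment> \<open>With \<open>s\<close> a square root of 5 and \<open>h\<close> one half, this is
    the golden ratio.\<close>
  have phi: "p dvd ((1 + s) * h) * ((1 + s) * h) - (1 + s) * h - 1" using s h by Groebner_Basis.algebra
  interpret icosahedral p i "(1 + s) * h" h t
    using i phi h t ndvd primes ne by unfold_locales auto
  show ?thesis using not_replacement assms(4) .
qed

end
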